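(* Let $W$ be any vector space over $\mathbb{C}$. Every maximal quasi local subspace $U$ of $\mathcal{E}(W)$ contains $1_W$ and is $\mathcal{Y}_\Gamma$-closed for any subgroup $\Gamma$ of $\mathbb{C}^\times$. Furthermore, for any quasi local subset $S$ of $\mathcal{E}(W)$ and for any subgroup $\Gamma$ of $\mathbb{C}^\times$, there exists a $\mathcal{Y}_\Gamma$-closed quasi local subspace of $\mathcal{E}(W)$ which contains $S$ and $1_W$.
   Context: All vector spaces are over $\mathbb{C}$; $x,x_0,x_1,x_2$ are commuting formal variables; $U((x))$ is the space of lower truncated Laurent series, $U((x_1))((x_2))=(U((x_1)))((x_2))$, $U((x_1,x_2))=U[[x_1,x_2]][x_1^{-1},x_2^{-1}]$. For a vector space $W$, $\mathcal{E}(W)=\operatorname{Hom}(W,W((x)))$, and $1_W\in\mathcal{E}(W)$ is the identity operator viewed as a constant series. Compatibility: an ordered pair $(a(x),b(x))$ in $\mathcal{E}(W)$ is compatible if there is a nonzero polynomial $f(x_1,x_2)\in\mathbb{C}[x_1,x_2]$ with $f(x_1,x_2)a(x_1)b(x_2)\in \operatorname{Hom}(W,W((x_1,x_2)))$. A subspace is pairwise compatible if every ordered pair in it is compatible. Partial operations: for a compatible pair $(a(x),b(x))$, such an $f$, and $\alpha\in\mathbb{C}^\times$, define $a(x)_{(\alpha,n)}b(x)$ ($n\in\mathbb{Z}$) by $$\mathcal{Y}_\alpha(a(x),x_0)b(x)=\sum_{n\in\mathbb{Z}}\bigl(a(x)_{(\alpha,n)}b(x)\bigr)x_0^{-n-1}=\iota_{x,x_0}\bigl(f(x_0+\alpha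 x,x)^{-1}\bigr)\,\bigl(f(x_1,x)a(x_1)b(x)\bigr)\big|_{x_1=\alpha x+x_0},$$ where $\iota_{x,x_0}(f(x_0+\alpha x,x)^{-1})$ is the inverse of the nonzero polynomial $f(x_0+\alpha x,x)$ in the field $\mathbb{C}((x))((x_0))$ and in the substitution powers of $\alpha x+x_0$ are expanded in nonnegative powers of $x_0$. This is independent of the choice of $f$, and $a(x)_{(\alpha,n)}b(x)\in\mathcal{E}(W)$. Quasi locality: $a(x),b(x)\in\mathcal{E}(W)$ are mutually quasi local if there is a nonzero polynomial $f(x_1,x_2)$ with $f(x_1,x_2)a(x_1)b(x_2)=f(x_1,x_2)b(x_2)a(x_1)$. A subset (subspace) of $\mathcal{E}(W)$ is quasi local if any two of its elements (possibly equal) are mutually quasi local. Any quasi local subspace is pairwise compatible. For a subgroup $\Gamma$ of $\mathbb{C}^\times$, a pairwise compatible subspace $U$ of $\mathcal{E}(W)$ is $\mathcal{Y}_\Gamma$-closed if $a(x)_{(\alpha,n)}b(x)\in U$ for all $a(x),b(x)\in U$, $\alpha\in\Gamma$, $n\in\mathbb{Z}$. *)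

theory Defs
  imports
    Complex_Main
    "HOL-Library.Function_Algebras"
    "HOL-Computational_Algebra.Computational_Algebra"
    "HOL-Algebra.Group"
begin

text \<open>
  A complex vector space \<open>W\<close> is a type \<open>'w\<close> with a scalar multiplication \<open>s\<close> such that
  \<open>vector_space s\<close>.  The space \<open>W((x))\<close> is the type \<open>'w fls\<close>, and \<open>W((x))((x\<^sub>0))\<close> is
  \<open>'w fls fls\<close>, where the outer variable is \<open>x\<^sub>0\<close> and the inner one is \<open>x\<close>.
  The space \<open>\<E>(W) = Hom(W, W((x)))\<close> is \<open>field_space s\<close> (``field'' in the sense of vertex algebras),
  with pointwise vector space operations.
\<close>

definition fls_scale :: "(complex \<Rightarrow> 'w::ab_group_add \<Rightarrow> 'w) \<Rightarrow> complex \<Rightarrow> 'w fls \<Rightarrow> 'w fls"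
  where "fls_scale s c v = Abs_fls (\<lambda>n. s c (fls_nth v n))"

definition field_space :: "(complex \<Rightarrow> 'w::ab_group_add \<Rightarrow> 'w) \<Rightarrow> ('w \<Rightarrow> 'w fls) set"
  where "field_space s = {a. Vector_Spaces.linear s (fls_scale s) a}"

definition field_scale ::
    "(complex \<Rightarrow> 'w::ab_group_add \<Rightarrow> 'w) \<Rightarrow> complex \<Rightarrow> ('w \<Rightarrow> 'w fls) \<Rightarrow> ('w \<Rightarrow> 'w fls)"
  where "field_scale s c a = (\<lambda>w. fls_scale s c (a w))"

definition field_subspace :: "(complex \<Rightarrow> 'w::ab_group_add \<Rightarrow> 'w) \<Rightarrow> ('w \<Rightarrow> 'w fls) set \<Rightarrow> bool"
  where "field_subspace s U \<longleftrightarrow> U \<subseteq> field_space s \<and> module.subspace (field_scale s) U"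

definition identity_field :: "'w::ab_group_add \<Rightarrow> 'w fls"
  where "identity_field = (\<lambda>w. fls_const w)"

text \<open>
  A series in \<open>W[[x\<^sub>1\<^sup>\<plusminus>\<^sup>1, x\<^sub>2\<^sup>\<plusminus>\<^sup>1]]\<close> is a function \<open>A :: int \<Rightarrow> int \<Rightarrow> 'w\<close>, where
  \<open>A m n\<close> is the coefficient of \<open>x\<^sub>1\<^sup>m x\<^sub>2\<^sup>n\<close>.
  A polynomial \<open>f(x\<^sub>1,x\<^sub>2)\<close> is an element of \<open>complex poly poly\<close>, where
  \<open>coeff (coeff f i) j\<close> is the coefficient of \<open>x\<^sub>1\<^sup>i x\<^sub>2\<^sup>j\<close>.
\<close>

definition poly_mult ::
    "(complex \<Rightarrow> 'w::ab_group_add \<Rightarrow> 'w) \<Rightarrow> complex poly poly \<Rightarrow> (int \<Rightarrow> int \<Rightarrow> 'w) \<Rightarrow> int \<Rightarrow> int \<Rightarrow> 'w"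
  where "poly_mult s f A m n =
    (\<Sum>i\<le>degree f. \<Sum>j\<le>degree (coeff f i). s (coeff (coeff f i) j) (A (m - int i) (n - int j)))"

text \<open>\<open>a(x\<^sub>1) b(x\<^sub>2) w\<close> and \<open>b(x\<^sub>2) a(x\<^sub>1) w\<close>, respectively:\<close>

definition prod12 :: "('w \<Rightarrow> 'w fls) \<Rightarrow> ('w \<Rightarrow> 'w fls) \<Rightarrow> 'w::ab_group_add \<Rightarrow> int \<Rightarrow> int \<Rightarrow> 'w"
  where "prod12 a b w m n = fls_nth (a (fls_nth (b w) n)) m"

definition prod21 :: "('w \<Rightarrow> 'w fls) \<Rightarrow> ('w \<Rightarrow> 'w fls) \<Rightarrow> 'w::ab_group_add \<Rightarrow> int \<Rightarrow> int \<Rightarrow> 'w"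
  where "prod21 a b w m n = fls_nth (b (fls_nth (a w) m)) n"

text \<open>Membership in \<open>W((x\<^sub>1,x\<^sub>2)) = W[[x\<^sub>1,x\<^sub>2]][x\<^sub>1\<^sup>-\<^sup>1,x\<^sub>2\<^sup>-\<^sup>1]\<close>:\<close>

definition lower_truncated2 :: "(int \<Rightarrow> int \<Rightarrow> 'w::zero) \<Rightarrow> bool"
  where "lower_truncated2 A \<longleftrightarrow> (\<exists>N. \<forall>m n. A m n \<noteq> 0 \<longrightarrow> N \<le> m \<and> N \<le> n)"

text \<open>
  For \<open>a, b \<in> field_space s\<close> the linearity of \<open>f(x\<^sub>1,x\<^sub>2) a(x\<^sub>1) b(x\<^sub>2)\<close> is automatic, so lying in
  \<open>Hom(W, W((x\<^sub>1,x\<^sub>2)))\<close> is a pointwise condition, with a bound that may depend on \<open>w\<close>.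
\<close>

definition compat_poly ::
    "(complex \<Rightarrow> 'w::ab_group_add \<Rightarrow> 'w) \<Rightarrow> ('w \<Rightarrow> 'w fls) \<Rightarrow> ('w \<Rightarrow> 'w fls) \<Rightarrow> complex poly poly \<Rightarrow> bool"
  where "compat_poly s a b f \<longleftrightarrow> f \<noteq> 0 \<and> (\<forall>w. lower_truncated2 (poly_mult s f (prod12 a b w)))"

definition compatible ::
    "(complex \<Rightarrow> 'w::ab_group_add \<Rightarrow> 'w) \<Rightarrow> ('w \<Rightarrow> 'w fls) \<Rightarrow> ('w \<Rightarrow> 'w fls) \<Rightarrow> bool"
  where "compatible s a b \<longleftrightarrow> (\<exists>f. compat_poly s a b f)"

definition pairwise_compatible_subspace ::
    "(complex \<Rightarrow> 'w::ab_group_add \<Rightarrow> 'w) \<Rightarrow> ('w \<Rightarrow> 'w fls) set \<Rightarrow> bool"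
  where "pairwise_compatible_subspace s U \<longleftrightarrow>
    field_subspace s U \<and> (\<forall>a\<in>U. \<forall>b\<in>U. compatible s a b)"

text \<open>
  \<open>fls_act s g v\<close> is the product of a scalar Laurent series \<open>g\<close> with a vector-valued one \<open>v\<close>, for a
  biadditive action \<open>s\<close> of coefficients on coefficients.  Thus \<open>fls_act s\<close> is the action of
  \<open>\<complex>((x))\<close> on \<open>W((x))\<close>, and \<open>fls_act (fls_act s)\<close> that of \<open>\<complex>((x))((x\<^sub>0))\<close> on \<open>W((x))((x\<^sub>0))\<close>.
\<close>

definition fls_act ::
    "('k::zero \<Rightarrow> 'v::comm_monoid_add \<Rightarrow> 'v) \<Rightarrow> 'k fls \<Rightarrow> 'v fls \<Rightarrow> 'v fls"
  where "fls_act s g v =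
    Abs_fls (\<lambda>n. \<Sum>i = fls_subdegree g..n - fls_subdegree v. s (fls_nth g i) (fls_nth v (n - i)))"

text \<open>\<open>f(x\<^sub>0 + \<alpha>x, x)\<close> in the field \<open>\<complex>((x))((x\<^sub>0))\<close>:\<close>

definition poly_subst :: "complex \<Rightarrow> complex poly poly \<Rightarrow> complex fls fls"
  where "poly_subst \<alpha> f =
    poly (map_poly (\<lambda>p. fls_const (fps_to_fls (fps_of_poly p))) f)
      (fls_X + fls_const (fls_const \<alpha> * fls_X))"

text \<open>
  \<open>A(x\<^sub>1,x)|\<close> at \<open>x\<^sub>1 = \<alpha>x + x\<^sub>0\<close> for \<open>A\<close> in \<open>W((x\<^sub>1,x))\<close>: since
  \<open>(\<alpha>x + x\<^sub>0)\<^sup>m = (\<Sum>k\<ge>0. binom(m,k) \<alpha>\<^sup>m\<^sup>-\<^sup>k x\<^sup>m\<^sup>-\<^sup>k x\<^sub>0\<^sup>k)\<close>, the coefficient of \<open>x\<^sub>0\<^sup>k x\<^sup>p\<close> receives the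
  contributions of those \<open>A m n\<close> with \<open>m - k + n = p\<close>; only finitely many of these are nonzero.
\<close>

definition series_subst_coeff ::
    "(complex \<Rightarrow> 'w::ab_group_add \<Rightarrow> 'w) \<Rightarrow> complex \<Rightarrow> (int \<Rightarrow> int \<Rightarrow> 'w) \<Rightarrow> nat \<Rightarrow> int \<Rightarrow> 'w"
  where "series_subst_coeff s \<alpha> A k p =
    (\<Sum>m | A m (p - m + int k) \<noteq> 0.
      s (((of_int m :: complex) gchoose k) * \<alpha> powi (m - int k)) (A m (p - m + int k)))"

definition series_subst ::
    "(complex \<Rightarrow> 'w::ab_group_add \<Rightarrow> 'w) \<Rightarrow> complex \<Rightarrow> (int \<Rightarrow> int \<Rightarrow> 'w) \<Rightarrow> 'w fls fls"
  where "series_subst s \<alpha> A =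
    fps_to_fls (Abs_fps (\<lambda>k. Abs_fls (series_subst_coeff s \<alpha> A k)))"

definition Y_series ::
    "(complex \<Rightarrow> 'w::ab_group_add \<Rightarrow> 'w) \<Rightarrow> complex \<Rightarrow> complex poly poly
      \<Rightarrow> ('w \<Rightarrow> 'w fls) \<Rightarrow> ('w \<Rightarrow> 'w fls) \<Rightarrow> 'w \<Rightarrow> 'w fls fls"
  where "Y_series s \<alpha> f a b w =
    fls_act (fls_act s) (inverse (poly_subst \<alpha> f))
      (series_subst s \<alpha> (poly_mult s f (prod12 a b w)))"

text \<open>\<open>a(x)\<^sub>(\<^sub>\<alpha>\<^sub>,\<^sub>n\<^sub>) b(x)\<close>; the value does not depend on the choice of the polynomial \<open>f\<close>.\<close>

definition Y_prod ::
    "(complex \<Rightarrow> 'w::ab_group_add \<Rightarrow> 'w) \<Rightarrow> complex \<Rightarrow> int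
      \<Rightarrow> ('w \<Rightarrow> 'w fls) \<Rightarrow> ('w \<Rightarrow> 'w fls) \<Rightarrow> ('w \<Rightarrow> 'w fls)"
  where "Y_prod s \<alpha> n a b =
    (\<lambda>w. fls_nth (Y_series s \<alpha> (SOME f. compat_poly s a b f) a b w) (- n - 1))"

definition Y_closed ::
    "(complex \<Rightarrow> 'w::ab_group_add \<Rightarrow> 'w) \<Rightarrow> complex set \<Rightarrow> ('w \<Rightarrow> 'w fls) set \<Rightarrow> bool"
  where "Y_closed s \<Gamma> U \<longleftrightarrow>
    pairwise_compatible_subspace s U \<and>
    (\<forall>a\<in>U. \<forall>b\<in>U. \<forall>\<alpha>\<in>\<Gamma>. \<forall>n. Y_prod s \<alpha> n a b \<in> U)"

definition mutually_quasi_local ::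
    "(complex \<Rightarrow> 'w::ab_group_add \<Rightarrow> 'w) \<Rightarrow> ('w \<Rightarrow> 'w fls) \<Rightarrow> ('w \<Rightarrow> 'w fls) \<Rightarrow> bool"
  where "mutually_quasi_local s a b \<longleftrightarrow>
    (\<exists>f. f \<noteq> 0 \<and> (\<forall>w. poly_mult s f (prod12 a b w) = poly_mult s f (prod21 a b w)))"

definition quasi_local :: "(complex \<Rightarrow> 'w::ab_group_add \<Rightarrow> 'w) \<Rightarrow> ('w \<Rightarrow> 'w fls) set \<Rightarrow> bool"
  where "quasi_local s S \<longleftrightarrow>
    S \<subseteq> field_space s \<and> (\<forall>a\<in>S. \<forall>b\<in>S. mutually_quasi_local s a b)"

definition maximal_quasi_local_subspace ::
    "(complex \<Rightarrow> 'w::ab_group_add \<Rightarrow> 'w) \<Rightarrow> ('w \<Rightarrow> 'w fls) set \<Rightarrow> bool"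
  where "maximal_quasi_local_subspace s U \<longleftrightarrow>
    field_subspace s U \<and> quasi_local s U \<and>
    (\<forall>V. field_subspace s V \<and> quasi_local s V \<and> U \<subseteq> V \<longrightarrow> V = U)"

definition nonzero_complex_group :: "complex monoid"
  where "nonzero_complex_group = \<lparr>carrier = - {0}, mult = (*), one = 1\<rparr>"


text \<open>
  The following facts confirm that the uses of \<^const>\<open>Abs_fls\<close> above are legitimate, i.e. that the
  series in question are lower truncated.
\<close>

lemma fls_nth_fls_scale:
  assumes "vector_space s"
  shows "fls_nth (fls_scale s c v) n = s c (fls_nth v n)"
proof -
  interpret vector_space s by fact
  show ?thesis
    unfolding fls_scale_def
    by (rule nth_Abs_fls_ex_lower_bound) (metis fls_eq0_below_subdegree scale_zero_right)
qed

lemma vector_space_fls_scale: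
  assumes "vector_space s"
  shows "vector_space (fls_scale s)"
proof -
  interpret vector_space s by fact
  show ?thesis
    by unfold_locales
      (auto intro!: fls_eqI simp: fls_nth_fls_scale[OF assms] scale_right_distrib scale_left_distrib)
qed

lemma vector_space_field_scale:
  assumes "vector_space s"
  shows "vector_space (field_scale s)"
proof -
  interpret vector_space "fls_scale s" by (rule vector_space_fls_scale) fact
  show ?thesis
    by unfold_locales
      (auto simp: field_scale_def fun_eq_iff scale_right_distrib scale_left_distrib)
qed

lemma fls_nth_fls_act:
  "fls_nth (fls_act s g v) n =
    (\<Sum>i = fls_subdegree g..n - fls_subdegree v. s (fls_nth g i) (fls_nth v (n - i)))"
  unfolding fls_act_def
  by (rule nth_Abs_fls_ex_lower_bound, rule exI[of _ "fls_subdegree g + fls_subdegree v"]) auto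

lemma finite_series_subst_support:
  assumes "lower_truncated2 A"
  shows "finite {m. A m (p - m + int k) \<noteq> 0}"
proof -
  obtain N where N: "\<And>m n. A m n \<noteq> 0 \<Longrightarrow> N \<le> m \<and> N \<le> n"
    using assms unfolding lower_truncated2_def by blast
  have "{m. A m (p - m + int k) \<noteq> 0} \<subseteq> {N..p + int k - N}"
    using N by fastforce
  then show ?thesis
    by (rule finite_subset) simp
qed

lemma fls_nth_series_subst:
  assumes "lower_truncated2 A"
  shows "fls_nth (fls_nth (series_subst s \<alpha> A) k) p =
    (if k < 0 then 0 else series_subst_coeff s \<alpha> A (nat k) p)"
proof -
  obtain N where N: "\<And>m n. A m n \<noteq> 0 \<Longrightarrow> N \<le> m \<and> N \<le> n"
    using assms unfolding lower_truncated2_def by blast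
  have "series_subst_coeff s \<alpha> A j q = 0" if "q < 2 * N - int j" for j q
  proof -
    have "{m. A m (q - m + int j) \<noteq> 0} = {}"
      using N that by fastforce
    then show ?thesis
      unfolding series_subst_coeff_def by (simp only: sum.empty)
  qed
  then have "fls_nth (Abs_fls (series_subst_coeff s \<alpha> A j)) q = series_subst_coeff s \<alpha> A j q" for j q
    by (intro nth_Abs_fls_ex_lower_bound) blast
  then show ?thesis
    by (simp add: series_subst_def)
qed

end

theory Submission
  imports Defs
begin

text \<open>
  The heart of the matter is an analogue of Dong's lemma: if \<open>a, b, c\<close> are pairwise quasi local, then
  so are \<open>a\<^sub>(\<^sub>\<alpha>\<^sub>,\<^sub>n\<^sub>) b\<close> and \<open>c\<close> (\<open>mutually_quasi_local_Y_prod\<close>).  Granting it, let \<open>U\<close> be a maximal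
  quasi local subspace and \<open>a, b \<in> U\<close>.  Then \<open>e = a\<^sub>(\<^sub>\<alpha>\<^sub>,\<^sub>n\<^sub>) b\<close> is quasi local with every \<open>c \<in> U\<close>;
  in particular with \<open>a\<close> and \<open>b\<close>, so that by symmetry and a second application (with \<open>c = e\<close>) it is
  quasi local with itself.  Quasi locality is inherited by linear spans, because annihilating
  polynomials can be multiplied, so \<open>e \<in> U\<close> by maximality.  The identity commutes with every field
  and lies in \<open>U\<close> for the same reason.  Finally, quasi locality is a condition on pairs, hence stable
  under unions of chains, and Zorn's lemma puts any quasi local set into a maximal quasi local subspace.

  For Dong's lemma, let \<open>p(x\<^sub>1,y)\<close> and \<open>q(x,y)\<close> kill the commutators \<open>[c(y), a(x\<^sub>1)]\<close> and
  \<open>[c(y), b(x)]\<close>.  Then \<open>p(x\<^sub>1,y) q(x,y)\<close> kills \<open>T = f(x\<^sub>1,x) [c(y), a(x\<^sub>1) b(x)]\<close>, whose coefficients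
  in \<open>y\<close> lie in \<open>W((x\<^sub>1,x))\<close>.  Substitute \<open>x\<^sub>1 = \<alpha>x + x\<^sub>0\<close> and write \<open>T = \<Sum>\<^sub>j T\<^sub>j(x,y) x\<^sub>0\<^sup>j\<close>.
  Since \<open>p(\<alpha>x + x\<^sub>0, y)\<close> and \<open>p(\<alpha>x, y)\<close> differ by a multiple of \<open>x\<^sub>0\<close>, each multiplication of
  \<open>q(x,y) T\<close> by \<open>p(\<alpha>x, y)\<close> raises its order in \<open>x\<^sub>0\<close>, so \<open>p(\<alpha>x, y)\<^sup>k q(x,y) T\<^sub>j = 0\<close> for \<open>j < k\<close>
  (\<open>poly_act_shift_annihilates\<close>).  The commutator of \<open>c(y)\<close> with \<open>a\<^sub>(\<^sub>\<alpha>\<^sub>,\<^sub>n\<^sub>) b\<close> is a finite combination of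
  the \<open>T\<^sub>j\<close> with coefficients in \<open>\<complex>((x))\<close>, which commute with multiplication by polynomials.

  All series spaces involved are modules over polynomial rings, the variables acting by index shifts,
  and all compatibilities (with coefficientwise linear maps, substitution, multiplication by Laurent
  series) are instances of one principle: a linear map that intertwines the actions of the variables
  intertwines the actions of polynomials (\<open>intertwines_poly_act\<close>).
\<close>

section \<open>Polynomials in commuting operators\<close>

text \<open>
  Evaluation of a polynomial at an operator \<open>X\<close>: if \<open>\<sigma>\<close> is an action of \<open>R\<close> on \<open>E\<close> with which \<open>X\<close>
  commutes, then \<open>poly_act \<sigma> X\<close> is the action of \<open>R[x]\<close> on \<open>E\<close> in which \<open>x\<close> acts as \<open>X\<close>.
  Iterating it gives actions of polynomials in several variables.
\<close>

definition poly_act ::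
    "('r::zero \<Rightarrow> 'e \<Rightarrow> 'e) \<Rightarrow> ('e \<Rightarrow> 'e) \<Rightarrow> 'r poly \<Rightarrow> 'e::comm_monoid_add \<Rightarrow> 'e"
  where "poly_act \<sigma> X f u = (\<Sum>i\<le>degree f. \<sigma> (coeff f i) ((X ^^ i) u))"

text \<open>
  \<open>\<phi>\<close> is a linear map from \<open>D\<close>, a subspace stable under \<open>\<sigma>\<close>, to a space on which \<open>\<tau>\<close> acts.  The domain
  is explicit because substitution is additive only on lower truncated series.
\<close>

definition intertwines ::
    "'d set \<Rightarrow> ('r \<Rightarrow> 'd \<Rightarrow> 'd) \<Rightarrow> ('r \<Rightarrow> 'e \<Rightarrow> 'e)
      \<Rightarrow> ('d::ab_group_add \<Rightarrow> 'e::ab_group_add) \<Rightarrow> bool"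
  where "intertwines D \<sigma> \<tau> \<phi> \<longleftrightarrow>
    0 \<in> D \<and> (\<forall>u\<in>D. \<forall>v\<in>D. u + v \<in> D \<and> \<phi> (u + v) = \<phi> u + \<phi> v) \<and>
    (\<forall>c. \<forall>u\<in>D. \<sigma> c u \<in> D \<and> \<phi> (\<sigma> c u) = \<tau> c (\<phi> u))"

text \<open>The entrywise action on families.\<close>

definition pointwise :: "('r \<Rightarrow> 'e \<Rightarrow> 'e) \<Rightarrow> 'r \<Rightarrow> ('i \<Rightarrow> 'e) \<Rightarrow> 'i \<Rightarrow> 'e"
  where "pointwise \<sigma> c F = (\<lambda>i. \<sigma> c (F i))"

lemma intertwinesD:
  assumes "intertwines D \<sigma> \<tau> \<phi>"
  shows "0 \<in> D" "u \<in> D \<Longrightarrow> v \<in> D \<Longrightarrow> u + v \<in> D"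
    "u \<in> D \<Longrightarrow> v \<in> D \<Longrightarrow> \<phi> (u + v) = \<phi> u + \<phi> v"
    "u \<in> D \<Longrightarrow> \<sigma> c u \<in> D" "u \<in> D \<Longrightarrow> \<phi> (\<sigma> c u) = \<tau> c (\<phi> u)" "\<phi> 0 = 0"
proof -
  show "\<phi> 0 = 0"
    using assms unfolding intertwines_def by (metis add_0 add_cancel_right_left)
qed (use assms in \<open>auto simp: intertwines_def\<close>)

lemma intertwines_UNIV_I:
  assumes "\<And>u v. \<phi> (u + v) = \<phi> u + \<phi> v" and "\<And>c u. \<phi> (\<sigma> c u) = \<tau> c (\<phi> u)"
  shows "intertwines UNIV \<sigma> \<tau> \<phi>"
  using assms by (simp add: intertwines_def)

lemma intertwines_poly_act:
  assumes "intertwines D \<sigma> \<tau> \<phi>" and X: "\<And>u. u \<in> D \<Longrightarrow> X u \<in> D \<and> \<phi> (X u) = X' (\<phi> u)"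
  shows "intertwines D (poly_act \<sigma> X) (poly_act \<tau> X') \<phi>"
proof -
  note I = intertwinesD[OF assms(1)]
  have pow: "(X ^^ i) u \<in> D \<and> \<phi> ((X ^^ i) u) = (X' ^^ i) (\<phi> u)" if "u \<in> D" for i u
    by (induction i) (use X that in auto)
  have "poly_act \<sigma> X f u \<in> D \<and> \<phi> (poly_act \<sigma> X f u) = poly_act \<tau> X' f (\<phi> u)" if "u \<in> D" for f u
  proof -
    have "(\<Sum>i\<in>A. \<sigma> (coeff f i) ((X ^^ i) u)) \<in> D \<and>
        \<phi> (\<Sum>i\<in>A. \<sigma> (coeff f i) ((X ^^ i) u)) = (\<Sum>i\<in>A. \<tau> (coeff f i) ((X' ^^ i) (\<phi> u)))"
      if "finite A" for A
      using that by (induction A) (use I pow \<open>u \<in> D\<close> in auto)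
    then show ?thesis by (simp add: poly_act_def)
  qed
  then show ?thesis using I by (simp add: intertwines_def)
qed

lemma module_pointwise:
  assumes "module \<sigma>"
  shows "module (pointwise \<sigma>)"
proof -
  interpret module \<sigma> by fact
  show ?thesis
    by unfold_locales
      (auto simp: pointwise_def fun_eq_iff scale_right_distrib scale_left_distrib)
qed

lemma intertwines_apply: "intertwines UNIV (pointwise \<sigma>) \<sigma> (\<lambda>F. F i)"
  by (simp add: intertwines_def pointwise_def)

lemma intertwines_comp:
  assumes "intertwines UNIV \<sigma> \<tau> \<phi>"
  shows "intertwines UNIV (pointwise \<sigma>) (pointwise \<tau>) ((\<circ>) \<phi>)"
  using assms by (auto simp: intertwines_def pointwise_def fun_eq_iff)

lemma poly_act_bound:
  assumes "module \<sigma>" and "degree f \<le> n"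
  shows "poly_act \<sigma> X f u = (\<Sum>i\<le>n. \<sigma> (coeff f i) ((X ^^ i) u))"
proof -
  interpret module \<sigma> by fact
  show ?thesis
    unfolding poly_act_def
    by (rule sum.mono_neutral_left) (use assms(2) in \<open>auto simp: coeff_eq_0\<close>)
qed

lemma poly_act_smult:
  assumes "module \<sigma>"
  shows "poly_act \<sigma> X (smult c f) u = \<sigma> c (poly_act \<sigma> X f u)"
proof -
  interpret module \<sigma> by fact
  show ?thesis
    unfolding poly_act_bound[OF assms degree_smult_le] by (simp add: poly_act_def scale_sum_right)
qed

lemma poly_act_pCons:
  assumes "module \<sigma>" and "intertwines UNIV \<sigma> \<sigma> X"
  shows "poly_act \<sigma> X (pCons c f) u = \<sigma> c u + X (poly_act \<sigma> X f u)"
proof -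
  interpret module \<sigma> by fact
  note I = intertwinesD[OF assms(2)]
  have X_sum: "X (sum h A) = (\<Sum>i\<in>A. X (h i))" if "finite A" for h and A :: "nat set"
    using that by (induction A) (use I in auto)
  have "poly_act \<sigma> X (pCons c f) u = (\<Sum>i\<le>Suc (degree f). \<sigma> (coeff (pCons c f) i) ((X ^^ i) u))"
    by (rule poly_act_bound[OF assms(1)]) (simp add: degree_pCons_le)
  also have "\<dots> = \<sigma> c u + X (poly_act \<sigma> X f u)"
    by (simp add: sum.atMost_Suc_shift X_sum poly_act_def I(5) del: sum.atMost_Suc)
  finally show ?thesis .
qed

lemma module_poly_act:
  assumes "module \<sigma>" and "intertwines UNIV \<sigma> \<sigma> X"
  shows "module (poly_act \<sigma> X)"
proof -
  interpret module \<sigma> by fact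
  note I = intertwinesD[OF assms(2), simplified]
  note pC = poly_act_pCons[OF assms]
  have pow: "intertwines UNIV \<sigma> \<sigma> (X ^^ i)" for i
    by (induction i) (use I in \<open>auto simp: intertwines_def\<close>)
  have add_left: "poly_act \<sigma> X (f + g) u = poly_act \<sigma> X f u + poly_act \<sigma> X g u" for f g u
  proof -
    let ?n = "max (degree f) (degree g)"
    have "degree (f + g) \<le> ?n" by (rule degree_add_le_max)
    then show ?thesis
      by (simp add: poly_act_bound[OF assms(1), of _ ?n] scale_left_distrib sum.distrib)
  qed
  have zero: "poly_act \<sigma> X 0 u = 0" for u by (simp add: poly_act_def)
  show ?thesis
  proof
    show "poly_act \<sigma> X f (u + v) = poly_act \<sigma> X f u + poly_act \<sigma> X f v" for f u v
      by (simp add: poly_act_def intertwinesD(3)[OF pow] scale_right_distrib sum.distrib)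
    show "poly_act \<sigma> X f (poly_act \<sigma> X g u) = poly_act \<sigma> X (f * g) u" for f g u
    proof (induction f)
      case 0
      show ?case by (simp add: zero)
    next
      case (pCons c f)
      then show ?case by (simp add: pC add_left poly_act_smult[OF assms(1)])
    qed
    show "poly_act \<sigma> X 1 u = u" for u by (simp add: poly_act_def)
  qed (fact add_left)
qed

lemma poly_act_pcompose_scale:
  assumes "module \<sigma>" and "intertwines UNIV \<sigma> \<sigma> X"
  shows "poly_act \<sigma> X (pcompose p [:0, c:]) u = poly_act \<sigma> (\<lambda>v. \<sigma> c (X v)) p u"
proof -
  interpret module \<sigma> by fact
  note I = intertwinesD[OF assms(2), simplified]
  have int: "intertwines UNIV \<sigma> \<sigma> (\<lambda>v. \<sigma> c (X v))"
    by (rule intertwines_UNIV_I) (simp_all add: I scale_right_distrib mult.commute)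
  show ?thesis
  proof (induction p)
    case 0
    show ?case by (simp add: poly_act_def)
  next
    case (pCons d p)
    have "poly_act \<sigma> X (pcompose (pCons d p) [:0, c:]) u =
        poly_act \<sigma> X (pCons d (smult c (pcompose p [:0, c:]))) u"
      by (simp add: pcompose_pCons)
    also have "\<dots> = \<sigma> d u + \<sigma> c (X (poly_act \<sigma> X (pcompose p [:0, c:]) u))"
      by (simp only: poly_act_pCons[OF assms] poly_act_smult[OF assms(1)] I)
    finally show ?case
      using pCons.IH by (simp add: poly_act_pCons[OF assms(1) int])
  qed
qed

lemma poly_act_commute:
  assumes "module \<sigma>" and "intertwines UNIV \<sigma> \<sigma> X" and "intertwines UNIV \<sigma> \<sigma> Z"
    and "\<And>u. X (Z u) = Z (X u)"
  shows "poly_act \<sigma> X p (poly_act \<sigma> Z q u) = poly_act \<sigma> Z q (poly_act \<sigma> X p u)"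
proof -
  have "intertwines UNIV (poly_act \<sigma> X) (poly_act \<sigma> X) Z"
    by (rule intertwines_poly_act[OF assms(3)]) (simp add: assms(4))
  note Z = intertwinesD[OF this, simplified]
  have "intertwines UNIV \<sigma> \<sigma> (poly_act \<sigma> X p)"
  proof (rule intertwines_UNIV_I)
    interpret module \<sigma> by fact
    interpret P: module "poly_act \<sigma> X" by (rule module_poly_act) fact+
    show "poly_act \<sigma> X p (u + v) = poly_act \<sigma> X p u + poly_act \<sigma> X p v" for u v
      by (rule P.scale_right_distrib)
    have "intertwines UNIV \<sigma> \<sigma> (\<sigma> c)" for c
      by (rule intertwines_UNIV_I) (simp_all add: scale_right_distrib mult.commute)
    then have "intertwines UNIV (poly_act \<sigma> X) (poly_act \<sigma> X) (\<sigma> c)" for c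
      by (rule intertwines_poly_act) (simp add: intertwinesD(5)[OF assms(2)])
    then show "poly_act \<sigma> X p (\<sigma> c u) = \<sigma> c (poly_act \<sigma> X p u)" for c u
      by (simp add: intertwines_def)
  qed
  then have "intertwines UNIV (poly_act \<sigma> Z) (poly_act \<sigma> Z) (poly_act \<sigma> X p)"
    by (rule intertwines_poly_act) (simp add: Z)
  then show ?thesis by (simp add: intertwines_def)
qed

lemma poly_act_pointwise:
  assumes "intertwines UNIV \<sigma> \<sigma> X"
  shows "poly_act (pointwise \<sigma>) ((\<circ>) X) = pointwise (poly_act \<sigma> X)"
proof (intro ext)
  fix f F i
  have "intertwines UNIV (poly_act (pointwise \<sigma>) ((\<circ>) X)) (poly_act \<sigma> X) (\<lambda>F. F i)"
    by (rule intertwines_poly_act[OF intertwines_apply]) simp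
  then show "poly_act (pointwise \<sigma>) ((\<circ>) X) f F i = pointwise (poly_act \<sigma> X) f F i"
    by (simp add: intertwines_def pointwise_def)
qed

text \<open>
  With \<open>F\<close> read as a power series \<open>\<Sum>\<^sub>j F j x\<^sub>0\<^sup>j\<close>, the operator \<open>Z\<close> is \<open>c X + x\<^sub>0\<close>.  If \<open>p(c X + x\<^sub>0) q(X)\<close>
  kills \<open>F\<close>, then \<open>p(c X)\<^sup>k q(X)\<close> maps \<open>F\<close> to a series of order at least \<open>k\<close>.
\<close>

lemma poly_act_shift_annihilates:
  fixes \<rho> :: "'r::comm_ring_1 \<Rightarrow> 'e::ab_group_add \<Rightarrow> 'e" and F :: "nat \<Rightarrow> 'e"
  assumes \<rho>: "module \<rho>" and X: "intertwines UNIV \<rho> \<rho> X"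
    and Z_def: "Z = (\<lambda>F k. \<rho> c (X (F k)) + (if k = 0 then 0 else F (k - 1)))"
    and ann: "poly_act (pointwise \<rho>) Z p (poly_act (pointwise \<rho>) ((\<circ>) X) q F) = 0"
    and "j < k"
  shows "poly_act \<rho> X (pcompose p [:0, c:] ^ k * q) (F j) = 0"
proof -
  interpret module \<rho> by fact
  note XI = intertwinesD[OF X, simplified]
  interpret PX: module "poly_act \<rho> X" by (rule module_poly_act) fact+
  have XX: "intertwines UNIV (pointwise \<rho>) (pointwise \<rho>) ((\<circ>) X)"
    by (rule intertwines_comp) fact
  have pw: "module (pointwise \<rho>)" by (rule module_pointwise) fact
  have Zi: "intertwines UNIV (pointwise \<rho>) (pointwise \<rho>) Z"
    by (rule intertwines_UNIV_I)
      (auto simp: Z_def fun_eq_iff pointwise_def XI scale_right_distrib mult.commute)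
  let ?PX = "poly_act (pointwise \<rho>) ((\<circ>) X) :: _ \<Rightarrow> (nat \<Rightarrow> 'e) \<Rightarrow> _"
  let ?PZ = "poly_act (pointwise \<rho>) Z"
  let ?X0 = "\<lambda>v. \<rho> c (X v)"
  let ?p0 = "pcompose p [:0, c:]"
  interpret PPX: module ?PX by (rule module_poly_act) fact+
  have X0: "intertwines UNIV \<rho> \<rho> ?X0"
    by (rule intertwines_UNIV_I) (simp_all add: XI scale_right_distrib mult.commute)
  have comm: "?PX f (?PZ g G) = ?PZ g (?PX f G)" for f g G
    by (rule poly_act_commute[OF pw XX Zi]) (auto simp: Z_def fun_eq_iff XI)
  have eval: "?PX f G i = poly_act \<rho> X f (G i)" for f G i
    by (simp add: poly_act_pointwise[OF X] pointwise_def)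
  \<comment> \<open>If \<open>G\<close> has order at least \<open>n\<close>, then so has its image under \<open>f(c X + x\<^sub>0)\<close>, and the two images
    under \<open>f(c X + x\<^sub>0)\<close> and \<open>f(c X)\<close> agree at order \<open>n\<close>.\<close>
  have filt: "(\<forall>i<n. ?PZ f G i = 0) \<and> ?PZ f G n = poly_act \<rho> X (pcompose f [:0, c:]) (G n)"
    if "\<And>i. i < n \<Longrightarrow> G i = 0" for f G n
    unfolding poly_act_pcompose_scale[OF \<rho> X]
  proof (induction f)
    case 0
    show ?case by (simp add: poly_act_def pointwise_def)
  next
    case (pCons d f)
    have "?PZ (pCons d f) G i =
        \<rho> d (G i) + (\<rho> c (X (?PZ f G i)) + (if i = 0 then 0 else ?PZ f G (i - 1)))" for i
      unfolding poly_act_pCons[OF pw Zi]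
      by (subst Z_def) (simp add: pointwise_def)
    then show ?case
      using pCons.IH that by (auto simp: poly_act_pCons[OF \<rho> X0] XI)
  qed
  have "\<forall>j<k. ?PX (?p0 ^ k * q) F j = 0"
  proof (induction k)
    case 0
    show ?case by simp
  next
    case (Suc k)
    let ?G = "?PX (?p0 ^ k * q) F"
    have "?PZ p ?G = ?PX (?p0 ^ k) (?PZ p (?PX q F))"
      by (simp only: comm flip: PPX.scale_scale)
    then have 0: "?PZ p ?G = 0" by (simp add: ann)
    have "?PX (?p0 ^ Suc k * q) F j = poly_act \<rho> X ?p0 (?G j)" for j
      by (simp add: eval mult.assoc)
    moreover have "poly_act \<rho> X ?p0 (?G k) = 0"
      using filt[of k ?G p] Suc.IH 0 by simp
    ultimately show ?case using Suc.IH by (metis PX.scale_zero_right less_Suc_eq)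
  qed
  then show ?thesis using \<open>j < k\<close> by (simp add: eval)
qed

section \<open>Series as modules over polynomial rings\<close>

text \<open>
  Multiplication by the variable whose exponent is the first argument of \<open>A\<close>.  Composing with it,
  \<open>(\<circ>) shift_index\<close>, is multiplication by the variable of the second argument, and so on.
\<close>

definition shift_index :: "(int \<Rightarrow> 'a) \<Rightarrow> int \<Rightarrow> 'a"
  where "shift_index A = (\<lambda>n. A (n - 1))"

lemma intertwines_shift_index: "intertwines UNIV (pointwise \<sigma>) (pointwise \<sigma>) shift_index"
  by (rule intertwines_UNIV_I) (auto simp: shift_index_def pointwise_def fun_eq_iff)

lemma sum_apply: "(\<Sum>i\<in>I. h i) x = (\<Sum>i\<in>I. h i x)"
  by (induction I rule: infinite_finite_induct) auto

lemma poly_mult_eq_poly_act: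
  "poly_mult s = poly_act (poly_act (pointwise (pointwise s)) ((\<circ>) shift_index)) shift_index"
proof (intro ext)
  fix f and A :: "int \<Rightarrow> int \<Rightarrow> 'a" and m n
  have 1: "(shift_index ^^ i) A m = A (m - int i)" for i m and A :: "int \<Rightarrow> 'b"
    by (induction i arbitrary: m) (auto simp: shift_index_def algebra_simps)
  have 2: "(((\<circ>) shift_index) ^^ i) A m n = A m (n - int i)" for i m n and A :: "int \<Rightarrow> int \<Rightarrow> 'a"
    by (induction i arbitrary: n) (auto simp: shift_index_def algebra_simps)
  show "poly_mult s f A m n =
      poly_act (poly_act (pointwise (pointwise s)) ((\<circ>) shift_index)) shift_index f A m n"
    by (simp add: poly_mult_def poly_act_def sum_apply pointwise_def 1 2)
qed

text \<open>
  The sum defining the action may start from any lower bound \<open>d\<close> of the support of \<open>v\<close>, not only from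
  the subdegree.
\<close>

lemma fls_nth_fls_act_wide:
  assumes "\<And>i. i < d \<Longrightarrow> fls_nth v i = 0" and "\<And>x. \<sigma> x 0 = 0"
  shows "fls_nth (fls_act \<sigma> g v) n =
    (\<Sum>i = fls_subdegree g..n - d. \<sigma> (fls_nth g i) (fls_nth v (n - i)))"
proof -
  let ?h = "\<lambda>i. \<sigma> (fls_nth g i) (fls_nth v (n - i))"
  let ?I = "{fls_subdegree g..n - min d (fls_subdegree v)}"
  have "sum ?h {fls_subdegree g..n - fls_subdegree v} = sum ?h ?I"
    by (rule sum.mono_neutral_left) (auto simp: assms(2))
  also have "\<dots> = sum ?h {fls_subdegree g..n - d}"
    by (rule sum.mono_neutral_right) (auto simp: assms)
  finally show ?thesis by (simp add: fls_nth_fls_act)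
qed

context
  fixes s :: "complex \<Rightarrow> 'w::ab_group_add \<Rightarrow> 'w"
  assumes vs: "vector_space s"
begin

interpretation vector_space s by (fact vs)

text \<open>
  The coefficientwise map of a Laurent series is given here by its result \<open>v'\<close>.
\<close>

lemma fls_act_map:
  assumes "intertwines UNIV s s \<psi>" and "\<And>i. fls_nth v' i = \<psi> (fls_nth v i)"
  shows "fls_nth (fls_act s g v') n = \<psi> (fls_nth (fls_act s g v) n)"
proof -
  note I = intertwinesD[OF assms(1), simplified]
  have \<psi>_sum: "\<psi> (sum h A) = (\<Sum>i\<in>A. \<psi> (h i))" for h and A :: "int set"
    by (induction A rule: infinite_finite_induct) (simp_all add: I)
  have "fls_nth (fls_act s g v') n =
      (\<Sum>i = fls_subdegree g..n - fls_subdegree v. s (fls_nth g i) (fls_nth v' (n - i)))"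
    by (rule fls_nth_fls_act_wide) (simp_all add: assms(2) I)
  then show ?thesis by (simp add: assms(2) fls_nth_fls_act \<psi>_sum I)
qed

lemma intertwines_fls_act: "intertwines UNIV (fls_scale s) (fls_scale s) (fls_act s g)"
proof (rule intertwines_UNIV_I)
  fix u v :: "'w fls"
  show "fls_act s g (u + v) = fls_act s g u + fls_act s g v"
  proof (rule fls_eqI)
    fix n
    define d where "d = min (fls_subdegree u) (fls_subdegree v)"
    have "fls_nth (fls_act s g x) n =
        (\<Sum>i = fls_subdegree g..n - d. s (fls_nth g i) (fls_nth x (n - i)))"
      if "x \<in> {u, v, u + v}" for x
      by (rule fls_nth_fls_act_wide) (use that in \<open>auto simp: d_def\<close>)
    then show "fls_nth (fls_act s g (u + v)) n = fls_nth (fls_act s g u + fls_act s g v) n"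
      by (simp add: scale_right_distrib sum.distrib)
  qed
next
  fix c v
  have "intertwines UNIV s s (s c)"
    by (rule intertwines_UNIV_I) (simp_all add: scale_right_distrib mult.commute)
  then show "fls_act s g (fls_scale s c v) = fls_scale s c (fls_act s g v)"
    by (intro fls_eqI) (simp add: fls_nth_fls_scale[OF vs] fls_act_map)
qed

lemma fls_act_shift: "fls_act s g (fls_shift (- 1) v) = fls_shift (- 1) (fls_act s g v)"
proof (rule fls_eqI)
  fix n
  have "fls_nth (fls_act s g (fls_shift (- 1) v)) n =
      (\<Sum>i = fls_subdegree g..n - (fls_subdegree v + 1). s (fls_nth g i) (fls_nth v (n - 1 - i)))"
    by (subst fls_nth_fls_act_wide[of "fls_subdegree v + 1"]) (auto simp: algebra_simps)
  then show "fls_nth (fls_act s g (fls_shift (- 1) v)) n = fls_nth (fls_shift (- 1) (fls_act s g v)) n"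
    by (simp add: fls_nth_fls_act algebra_simps)
qed

lemma field_space_mode:
  assumes "a \<in> field_space s"
  shows "intertwines UNIV s s (\<lambda>w. fls_nth (a w) n)"
  using assms
  by (intro intertwines_UNIV_I) (auto simp: field_space_def Vector_Spaces.linear_iff fls_nth_fls_scale[OF vs])

lemma field_space_iff: "a \<in> field_space s \<longleftrightarrow> intertwines UNIV s (fls_scale s) a"
  using vs vector_space_fls_scale[OF vs]
  by (auto simp: field_space_def Vector_Spaces.linear_iff intertwines_def)

lemma module_coeffs2: "module (pointwise (pointwise s))"
  by (intro module_pointwise) (rule module_axioms)

lemma intertwines_inner_shift:
  "intertwines UNIV (pointwise (pointwise \<sigma>)) (pointwise (pointwise \<sigma>)) ((\<circ>) shift_index)"
  by (intro intertwines_comp intertwines_shift_index)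

lemma module_poly_mult: "module (poly_mult s)"
  unfolding poly_mult_eq_poly_act
proof (rule module_poly_act)
  show "module (poly_act (pointwise (pointwise s)) ((\<circ>) shift_index))"
    by (intro module_poly_act module_coeffs2 intertwines_inner_shift)
  show "intertwines UNIV (poly_act (pointwise (pointwise s)) ((\<circ>) shift_index))
      (poly_act (pointwise (pointwise s)) ((\<circ>) shift_index)) shift_index"
    by (intro intertwines_poly_act intertwines_shift_index) (auto simp: shift_index_def fun_eq_iff)
qed

section \<open>Expansion at \<open>x\<^sub>1 = \<alpha>x + x\<^sub>0\<close>\<close>

lemma series_subst_coeff_eq_sum:
  assumes "finite M" and "\<And>m. A m (p - m + int k) \<noteq> 0 \<Longrightarrow> m \<in> M"
  shows "series_subst_coeff s \<alpha> A k p =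
    (\<Sum>m\<in>M. s (((of_int m :: complex) gchoose k) * \<alpha> powi (m - int k)) (A m (p - m + int k)))"
  unfolding series_subst_coeff_def
  by (rule sum.mono_neutral_left) (use assms in auto)

lemma lower_truncated2_closed:
  shows "lower_truncated2 (0 :: int \<Rightarrow> int \<Rightarrow> 'w)"
    and "lower_truncated2 A \<Longrightarrow> lower_truncated2 B \<Longrightarrow> lower_truncated2 (A + B)"
    and "lower_truncated2 A \<Longrightarrow> lower_truncated2 (pointwise (pointwise s) c A)"
    and "lower_truncated2 A \<Longrightarrow> lower_truncated2 (shift_index A)"
    and "lower_truncated2 A \<Longrightarrow> lower_truncated2 (shift_index \<circ> A)"
proof -
  show "lower_truncated2 (0 :: int \<Rightarrow> int \<Rightarrow> 'w)" by (simp add: lower_truncated2_def)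
next
  assume "lower_truncated2 A" "lower_truncated2 B"
  then obtain M N where "\<And>m n. A m n \<noteq> 0 \<Longrightarrow> M \<le> m \<and> M \<le> n" "\<And>m n. B m n \<noteq> 0 \<Longrightarrow> N \<le> m \<and> N \<le> n"
    unfolding lower_truncated2_def by blast
  then have "(A + B) m n \<noteq> 0 \<Longrightarrow> min M N \<le> m \<and> min M N \<le> n" for m n
    by (metis add_0 min.coboundedI1 min.coboundedI2 plus_fun_apply)
  then show "lower_truncated2 (A + B)" unfolding lower_truncated2_def by blast
next
  assume "lower_truncated2 A"
  then obtain N where N: "\<And>m n. A m n \<noteq> 0 \<Longrightarrow> N \<le> m \<and> N \<le> n"
    unfolding lower_truncated2_def by blast
  show "lower_truncated2 (pointwise (pointwise s) c A)"
    unfolding lower_truncated2_def pointwise_def using N by (metis scale_zero_right)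
  show "lower_truncated2 (shift_index A)" "lower_truncated2 (shift_index \<circ> A)"
    unfolding lower_truncated2_def shift_index_def using N by force+
qed

lemma intertwines_series_subst:
  "intertwines {A. lower_truncated2 A} (pointwise (pointwise s)) (fls_scale s)
    (\<lambda>A. fls_nth (series_subst s \<alpha> A) (int k))"
proof -
  have "fls_nth (series_subst s \<alpha> (A + B)) (int k) =
      fls_nth (series_subst s \<alpha> A) (int k) + fls_nth (series_subst s \<alpha> B) (int k)"
    if "lower_truncated2 A" "lower_truncated2 B" for A B
  proof (rule fls_eqI)
    fix p
    let ?M = "{m. A m (p - m + int k) \<noteq> 0} \<union> {m. B m (p - m + int k) \<noteq> 0}"
    have "finite ?M" using that by (simp add: finite_series_subst_support)
    then have "series_subst_coeff s \<alpha> C k p =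
        (\<Sum>m\<in>?M. s (((of_int m :: complex) gchoose k) * \<alpha> powi (m - int k)) (C m (p - m + int k)))"
      if "C \<in> {A, B, A + B}" for C
      by (rule series_subst_coeff_eq_sum) (use that in auto)
    then show "fls_nth (fls_nth (series_subst s \<alpha> (A + B)) (int k)) p =
        fls_nth (fls_nth (series_subst s \<alpha> A) (int k) + fls_nth (series_subst s \<alpha> B) (int k)) p"
      using that
      by (simp add: fls_nth_series_subst lower_truncated2_closed scale_right_distrib sum.distrib)
  qed
  moreover have "fls_nth (series_subst s \<alpha> (pointwise (pointwise s) c A)) (int k) =
      fls_scale s c (fls_nth (series_subst s \<alpha> A) (int k))" if A: "lower_truncated2 A" for c A
  proof (rule fls_eqI)
    fix p
    let ?M = "{m. A m (p - m + int k) \<noteq> 0}"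
    have "finite ?M" using that by (simp add: finite_series_subst_support)
    then have "series_subst_coeff s \<alpha> (pointwise (pointwise s) c A) k p =
        s c (series_subst_coeff s \<alpha> A k p)"
      by (subst (1 2) series_subst_coeff_eq_sum[of ?M])
        (auto simp: pointwise_def scale_sum_right mult_ac)
    then show "fls_nth (fls_nth (series_subst s \<alpha> (pointwise (pointwise s) c A)) (int k)) p =
        fls_nth (fls_scale s c (fls_nth (series_subst s \<alpha> A) (int k))) p"
      using A by (simp add: fls_nth_series_subst lower_truncated2_closed fls_nth_fls_scale[OF vs])
  qed
  ultimately show ?thesis
    by (simp add: intertwines_def lower_truncated2_closed)
qed

lemma series_subst_map:
  assumes "intertwines UNIV s s \<psi>" and "lower_truncated2 A"
  shows "lower_truncated2 (\<lambda>m n. \<psi> (A m n))"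
    and "fls_nth (fls_nth (series_subst s \<alpha> (\<lambda>m n. \<psi> (A m n))) k) p =
      \<psi> (fls_nth (fls_nth (series_subst s \<alpha> A) k) p)"
proof -
  note I = intertwinesD[OF assms(1), simplified]
  obtain N where "\<And>m n. A m n \<noteq> 0 \<Longrightarrow> N \<le> m \<and> N \<le> n"
    using assms(2) unfolding lower_truncated2_def by blast
  then have "\<psi> (A m n) \<noteq> 0 \<Longrightarrow> N \<le> m \<and> N \<le> n" for m n
    using I(6) by (cases "A m n = 0") auto
  then show lt: "lower_truncated2 (\<lambda>m n. \<psi> (A m n))"
    unfolding lower_truncated2_def by blast
  have \<psi>_sum: "\<psi> (sum h M) = (\<Sum>i\<in>M. \<psi> (h i))" for h and M :: "int set"
    by (induction M rule: infinite_finite_induct) (simp_all add: I)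
  have "series_subst_coeff s \<alpha> (\<lambda>m n. \<psi> (A m n)) j p = \<psi> (series_subst_coeff s \<alpha> A j p)" for j
  proof -
    have "finite {m. A m (p - m + int j) \<noteq> 0}"
      using assms(2) by (rule finite_series_subst_support)
    then show ?thesis
      by (subst series_subst_coeff_eq_sum[where M = "{m. A m (p - m + int j) \<noteq> 0}"])
        (auto simp: I \<psi>_sum series_subst_coeff_def)
  qed
  then show "fls_nth (fls_nth (series_subst s \<alpha> (\<lambda>m n. \<psi> (A m n))) k) p =
      \<psi> (fls_nth (fls_nth (series_subst s \<alpha> A) k) p)"
    by (simp add: fls_nth_series_subst[OF assms(2)] fls_nth_series_subst[OF lt] I)
qed

lemma series_subst_shift_inner:
  assumes "lower_truncated2 A"
  shows "fls_nth (series_subst s \<alpha> (shift_index \<circ> A)) (int k) =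
    fls_shift (- 1) (fls_nth (series_subst s \<alpha> A) (int k))"
proof (rule fls_eqI)
  fix p
  have "p - m + int k - 1 = p - 1 - m + int k" for m by simp
  then have "series_subst_coeff s \<alpha> (shift_index \<circ> A) k p = series_subst_coeff s \<alpha> A k (p - 1)"
    by (simp only: series_subst_coeff_def shift_index_def o_apply)
  then show "fls_nth (fls_nth (series_subst s \<alpha> (shift_index \<circ> A)) (int k)) p =
      fls_nth (fls_shift (- 1) (fls_nth (series_subst s \<alpha> A) (int k))) p"
    using assms by (simp add: fls_nth_series_subst lower_truncated2_closed)
qed

text \<open>
  Substitution turns multiplication by \<open>x\<^sub>1\<close> into multiplication by \<open>\<alpha>x + x\<^sub>0\<close>; on coefficients this is
  Pascal's rule for the binomial coefficients \<open>binom(m, k)\<close> with \<open>m\<close> an integer.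
\<close>

lemma series_subst_shift_outer:
  assumes "lower_truncated2 A" and "\<alpha> \<noteq> 0"
  shows "fls_nth (series_subst s \<alpha> (shift_index A)) (int k) =
    fls_scale s \<alpha> (fls_shift (- 1) (fls_nth (series_subst s \<alpha> A) (int k))) +
    (if k = 0 then 0 else fls_nth (series_subst s \<alpha> A) (int (k - 1)))"
proof (rule fls_eqI)
  fix p
  define M where "M = {m. A m (p - 1 - m + int k) \<noteq> 0}"
  have M: "finite M"
    unfolding M_def using assms(1) by (rule finite_series_subst_support)
  have "series_subst_coeff s \<alpha> (shift_index A) k p =
      (\<Sum>m\<in>(\<lambda>m. m + 1) ` M. s (((of_int m :: complex) gchoose k) * \<alpha> powi (m - int k))
        (shift_index A m (p - m + int k)))"
  proof (rule series_subst_coeff_eq_sum)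
    fix m
    assume "shift_index A m (p - m + int k) \<noteq> 0"
    then have "m - 1 \<in> M" by (simp add: shift_index_def M_def algebra_simps)
    then show "m \<in> (\<lambda>m. m + 1) ` M" by force
  qed (use M in simp)
  also have "\<dots> = (\<Sum>m\<in>M. s (((of_int m + 1 :: complex) gchoose k) * \<alpha> powi (m + 1 - int k))
        (A m (p - 1 - m + int k)))"
    by (subst sum.reindex) (auto simp: shift_index_def algebra_simps inj_on_def)
  finally have shifted: "series_subst_coeff s \<alpha> (shift_index A) k p = \<dots>" .
  have powi: "\<alpha> powi (m + 1 - int k) = \<alpha> * \<alpha> powi (m - int k)" for m
    using power_int_add_1'[of \<alpha> "m - int k"] assms(2) by (simp add: algebra_simps)
  have first: "s \<alpha> (series_subst_coeff s \<alpha> A k (p - 1)) =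
      (\<Sum>m\<in>M. s (((of_int m :: complex) gchoose k) * \<alpha> powi (m + 1 - int k))
        (A m (p - 1 - m + int k)))"
    by (subst series_subst_coeff_eq_sum[OF M]) (auto simp: M_def scale_sum_right powi mult_ac)
  show "fls_nth (fls_nth (series_subst s \<alpha> (shift_index A)) (int k)) p =
      fls_nth (fls_scale s \<alpha> (fls_shift (- 1) (fls_nth (series_subst s \<alpha> A) (int k))) +
        (if k = 0 then 0 else fls_nth (series_subst s \<alpha> A) (int (k - 1)))) p"
  proof (cases k)
    case 0
    then show ?thesis
      using assms(1) first shifted
      by (simp add: fls_nth_series_subst lower_truncated2_closed fls_nth_fls_scale[OF vs])
  next
    case (Suc j)
    have "series_subst_coeff s \<alpha> A j p =
      (\<Sum>m\<in>M. s (((of_int m :: complex) gchoose j) * \<alpha> powi (m - int j)) (A m (p - m + int j)))"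
      by (rule series_subst_coeff_eq_sum[OF M]) (auto simp: M_def Suc algebra_simps)
    also have "\<dots> = (\<Sum>m\<in>M. s (((of_int m :: complex) gchoose j) * \<alpha> powi (m + 1 - int k))
        (A m (p - 1 - m + int k)))"
      by (simp add: Suc algebra_simps)
    finally have "series_subst_coeff s \<alpha> (shift_index A) k p =
        s \<alpha> (series_subst_coeff s \<alpha> A k (p - 1)) + series_subst_coeff s \<alpha> A j p"
      unfolding shifted first
      by (simp add: Suc gbinomial_Suc_Suc scale_left_distrib distrib_right flip: sum.distrib)
        (simp add: add.commute)
    then show ?thesis
      using assms(1) Suc
      by (simp add: fls_nth_series_subst lower_truncated2_closed fls_nth_fls_scale[OF vs]
          del: of_nat_Suc)
  qed
qed

section \<open>Compatibility, quasi locality and the partial operations\<close>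

lemma poly_mult_shift:
  "poly_mult s f (shift_index A) = shift_index (poly_mult s f A)"
  "poly_mult s f (\<lambda>m. shift_index (A m)) m = shift_index (poly_mult s f A m)"
proof -
  have "k - int i - 1 = k - 1 - int i" for k i by simp
  then show "poly_mult s f (shift_index A) = shift_index (poly_mult s f A)"
    "poly_mult s f (\<lambda>m. shift_index (A m)) m = shift_index (poly_mult s f A m)"
    by (simp_all only: poly_mult_def shift_index_def fun_eq_iff simp_thms)
qed

lemma mutually_quasi_local_iff:
  "mutually_quasi_local s a b \<longleftrightarrow>
    (\<exists>f. f \<noteq> 0 \<and> (\<forall>w. poly_mult s f (prod21 a b w - prod12 a b w) = 0))"
proof -
  interpret P: module "poly_mult s" by (rule module_poly_mult)
  show ?thesis
    unfolding mutually_quasi_local_def P.scale_right_diff_distrib by (metis right_minus_eq)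
qed

text \<open>Exchanging the two variables of a polynomial.\<close>

lemma poly_mult_swap:
  assumes "f \<noteq> 0"
  obtains g where "g \<noteq> 0" and "\<And>A m n. poly_mult s g A m n = poly_mult s f (\<lambda>m n. A n m) n m"
proof -
  define J where "J = Max ((\<lambda>i. degree (coeff f i)) ` {..degree f})"
  have J: "degree (coeff f i) \<le> J" if "i \<le> degree f" for i
    unfolding J_def using that by (intro Max_ge) auto
  \<comment> \<open>\<open>J\<close> bounds the degree of \<open>f\<close> in the inner variable, so that the double sum is over a rectangle
    and its order can be exchanged.\<close>
  define g where "g = (\<Sum>i\<le>degree f. \<Sum>j\<le>J. monom (monom (coeff (coeff f i) j) i) j)"
  have inner: "coeff (\<Sum>j\<le>J. monom (monom (coeff (coeff f i) j) i) j) l =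
      (if l \<le> J then monom (coeff (coeff f i) l) i else 0)" for i l
    by (simp add: coeff_sum)
  have coeff_g: "coeff (coeff g j) i = coeff (coeff f i) j" for i j
  proof (cases "i \<le> degree f \<and> j \<le> J")
    case True
    then show ?thesis by (simp add: g_def coeff_sum inner)
  next
    case False
    then have "coeff (coeff f i) j = 0"
      using J[of i] by (cases "i \<le> degree f") (auto simp: coeff_eq_0)
    then show ?thesis using False by (auto simp: g_def coeff_sum inner intro!: sum.neutral)
  qed
  have wide: "poly_mult s h A m n =
      (\<Sum>i\<le>I. \<Sum>j\<le>K. s (coeff (coeff h i) j) (A (m - int i) (n - int j)))"
    if "\<And>i j. I < i \<or> K < j \<Longrightarrow> coeff (coeff h i) j = 0" for h A m n I K
  proof -
    have dK: "degree (coeff h i) \<le> K" for i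
      using that by (intro degree_le) blast
    have dI: "degree h \<le> I"
      using that by (intro degree_le) (auto simp: poly_eq_iff)
    have "poly_mult s h A m n =
        (\<Sum>i\<le>degree h. \<Sum>j\<le>K. s (coeff (coeff h i) j) (A (m - int i) (n - int j)))"
      unfolding poly_mult_def
      by (intro sum.cong refl sum.mono_neutral_left) (use dK in \<open>auto simp: coeff_eq_0\<close>)
    also have "\<dots> = (\<Sum>i\<le>I. \<Sum>j\<le>K. s (coeff (coeff h i) j) (A (m - int i) (n - int j)))"
      by (intro sum.mono_neutral_left) (use dI in \<open>auto simp: coeff_eq_0\<close>)
    finally show ?thesis .
  qed
  have f0: "coeff (coeff f i) j = 0" if "degree f < i \<or> J < j" for i j
  proof (cases "i \<le> degree f")
    case True
    then show ?thesis using that J[of i] by (intro coeff_eq_0) auto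
  qed (simp add: coeff_eq_0)
  show thesis
  proof
    show "g \<noteq> 0"
      using assms coeff_g by (metis coeff_0 poly_eqI)
    show "poly_mult s g A m n = poly_mult s f (\<lambda>m n. A n m) n m" for A m n
    proof -
      have "poly_mult s g A m n =
          (\<Sum>j\<le>J. \<Sum>i\<le>degree f. s (coeff (coeff f i) j) (A (m - int j) (n - int i)))"
        by (subst wide[of J "degree f"]) (auto simp: coeff_g f0)
      also have "\<dots> = poly_mult s f (\<lambda>m n. A n m) n m"
        by (subst wide[of "degree f" J]) (auto simp: f0 intro: sum.swap)
      finally show ?thesis .
    qed
  qed
qed

lemma mutually_quasi_local_sym:
  assumes "mutually_quasi_local s a b"
  shows "mutually_quasi_local s b a"
proof -
  obtain f where "f \<noteq> 0"
    and f: "\<And>w. poly_mult s f (prod12 a b w) = poly_mult s f (prod21 a b w)"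
    using assms unfolding mutually_quasi_local_def by blast
  from \<open>f \<noteq> 0\<close> obtain g where "g \<noteq> 0"
    and g: "\<And>A m n. poly_mult s g A m n = poly_mult s f (\<lambda>m n. A n m) n m"
    by (rule poly_mult_swap) blast
  have "(\<lambda>m n. prod12 b a w n m) = prod21 a b w" "(\<lambda>m n. prod21 b a w n m) = prod12 a b w" for w
    by (simp_all add: prod12_def prod21_def fun_eq_iff)
  then have "poly_mult s g (prod12 b a w) = poly_mult s g (prod21 b a w)" for w
    by (simp add: fun_eq_iff g f)
  with \<open>g \<noteq> 0\<close> show ?thesis
    unfolding mutually_quasi_local_def by blast
qed

text \<open>
  One side of the locality identity is truncated in \<open>x\<^sub>2\<close>, the other in \<open>x\<^sub>1\<close>.
\<close>

lemma compatible_if_mutually_quasi_local: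
  assumes "a \<in> field_space s" and "b \<in> field_space s" and "mutually_quasi_local s a b"
  shows "compatible s a b"
proof -
  obtain f where "f \<noteq> 0"
    and f: "\<And>w. poly_mult s f (prod12 a b w) = poly_mult s f (prod21 a b w)"
    using assms(3) unfolding mutually_quasi_local_def by blast
  note a0 = intertwinesD(6)[OF field_space_mode[OF assms(1)]]
  note b0 = intertwinesD(6)[OF field_space_mode[OF assms(2)]]
  have "lower_truncated2 (poly_mult s f (prod12 a b w))" for w
  proof -
    define N where "N = min (fls_subdegree (a w)) (fls_subdegree (b w))"
    have "poly_mult s f (prod12 a b w) m n = 0" if "n < N" for m n
      using that by (simp add: poly_mult_def prod12_def N_def a0)
    moreover have "poly_mult s f (prod21 a b w) m n = 0" if "m < N" for m n
      using that by (simp add: poly_mult_def prod21_def N_def b0)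
    ultimately show ?thesis
      unfolding lower_truncated2_def f by (metis f linorder_not_le)
  qed
  with \<open>f \<noteq> 0\<close> show ?thesis
    unfolding compatible_def compat_poly_def by blast
qed

lemma identity_field_in_field_space: "identity_field \<in> field_space s"
  unfolding field_space_iff
  by (rule intertwines_UNIV_I)
    (auto intro!: fls_eqI simp: identity_field_def fls_nth_fls_scale[OF vs])

lemma mutually_quasi_local_identity_field:
  assumes "a \<in> field_space s"
  shows "mutually_quasi_local s identity_field a"
proof -
  note a0 = intertwinesD(6)[OF field_space_mode[OF assms]]
  have "prod12 identity_field a w = prod21 identity_field a w" for w
    by (auto simp: prod12_def prod21_def identity_field_def fun_eq_iff a0)
  then show ?thesis
    unfolding mutually_quasi_local_def by (intro exI[of _ 1]) simp
qed

text \<open>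
  The sum may end at \<open>- n - 1\<close> because the substituted series has no negative powers of \<open>x\<^sub>0\<close>.
\<close>

lemma Y_prod_eq_sum:
  "Y_prod s \<alpha> n a b w =
    (let f = SOME f. compat_poly s a b f; g = inverse (poly_subst \<alpha> f) in
      \<Sum>i = fls_subdegree g..- n - 1. fls_act s (fls_nth g i)
        (fls_nth (series_subst s \<alpha> (poly_mult s f (prod12 a b w))) (- n - 1 - i)))"
  unfolding Y_prod_def Y_series_def Let_def
  by (subst fls_nth_fls_act_wide[where d = 0])
    (simp_all add: series_subst_def intertwinesD(6)[OF intertwines_fls_act])

lemma Y_prod_in_field_space:
  assumes a: "a \<in> field_space s" and b: "b \<in> field_space s" and "compatible s a b"
  shows "Y_prod s \<alpha> n a b \<in> field_space s"
proof -
  interpret FS: vector_space "fls_scale s" by (rule vector_space_fls_scale) (rule vs)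
  interpret P: module "poly_mult s" by (rule module_poly_mult)
  define f where "f = (SOME f. compat_poly s a b f)"
  define g where "g = inverse (poly_subst \<alpha> f)"
  have f: "compat_poly s a b f"
    using \<open>compatible s a b\<close> unfolding f_def compatible_def by (rule someI_ex)
  let ?D = "\<lambda>k w. fls_nth (series_subst s \<alpha> (poly_mult s f (prod12 a b w))) k"
  note aI = intertwinesD[OF field_space_mode[OF a], simplified]
  note bI = intertwinesD[OF field_space_mode[OF b], simplified]
  have trunc: "lower_truncated2 (poly_mult s f (prod12 a b w))" for w
    using f by (simp add: compat_poly_def)
  have prod_add: "prod12 a b (u + v) = prod12 a b u + prod12 a b v" for u v
    by (simp add: prod12_def fun_eq_iff aI bI)
  have prod_scale: "poly_mult s f (prod12 a b (s c u)) =
      pointwise (pointwise s) c (poly_mult s f (prod12 a b u))" for c u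
    by (simp add: poly_mult_def prod12_def fun_eq_iff pointwise_def aI bI scale_sum_right mult.commute)
  have D: "intertwines UNIV s (fls_scale s) (?D k)" for k
  proof (cases "k < 0")
    case True
    then show ?thesis by (simp add: intertwines_def series_subst_def)
  next
    case False
    then obtain j where "k = int j" by (metis nonneg_int_cases not_less)
    then show ?thesis
      using intertwinesD[OF intertwines_series_subst[of \<alpha> j]] trunc
      by (intro intertwines_UNIV_I) (simp_all add: prod_add prod_scale P.scale_right_distrib)
  qed
  note DI = intertwinesD[OF D, simplified]
  have G: "fls_act s h (u + v) = fls_act s h u + fls_act s h v"
    "fls_act s h (fls_scale s c u) = fls_scale s c (fls_act s h u)" for h u v c
    using intertwinesD[OF intertwines_fls_act] by auto
  show ?thesis
    unfolding field_space_iff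
    by (intro intertwines_UNIV_I)
      (simp_all add: Y_prod_eq_sum Let_def f_def[symmetric] g_def[symmetric] DI G sum.distrib
        FS.scale_sum_right)
qed

section \<open>Quasi locality of the partial operations\<close>

text \<open>
  Series in \<open>y, x\<^sub>1, x\<close> are functions \<open>T\<close> with \<open>T l m n\<close> the coefficient of \<open>y\<^sup>l x\<^sub>1\<^sup>m x\<^sup>n\<close>.  The next two
  constants are the actions on them of polynomials in \<open>x\<^sub>1, y\<close> and in \<open>x, y\<close>, the variable named
  first being the outer one.
\<close>

definition act_x1_y :: "complex poly poly \<Rightarrow> (int \<Rightarrow> int \<Rightarrow> int \<Rightarrow> 'w) \<Rightarrow> int \<Rightarrow> int \<Rightarrow> int \<Rightarrow> 'w"
  where "act_x1_y =
    poly_act (poly_act (pointwise (pointwise (pointwise s))) shift_index) ((\<circ>) shift_index)"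

definition act_x_y :: "complex poly poly \<Rightarrow> (int \<Rightarrow> int \<Rightarrow> int \<Rightarrow> 'w) \<Rightarrow> int \<Rightarrow> int \<Rightarrow> int \<Rightarrow> 'w"
  where "act_x_y =
    poly_act (poly_act (pointwise (pointwise (pointwise s))) shift_index) ((\<circ>) ((\<circ>) shift_index))"

text \<open>
  A series in \<open>y\<close> with coefficients in \<open>W((x))\<close> is a function \<open>int \<Rightarrow> 'w fls\<close>; polynomials in
  \<open>x, y\<close>, with \<open>x\<close> outer, act on it as follows.
\<close>

definition act_fls :: "complex poly poly \<Rightarrow> (int \<Rightarrow> 'w fls) \<Rightarrow> int \<Rightarrow> 'w fls"
  where "act_fls =
    poly_act (poly_act (pointwise (fls_scale s)) shift_index) ((\<circ>) (fls_shift (- 1)))"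

lemma module_act_y: "module (poly_act (pointwise (pointwise (pointwise s))) shift_index)"
  by (intro module_poly_act module_pointwise module_axioms intertwines_shift_index)

lemma intertwines_shift_act_y:
  defines "\<sigma> \<equiv> poly_act (pointwise (pointwise (pointwise s))) shift_index"
  shows "intertwines UNIV \<sigma> \<sigma> ((\<circ>) shift_index)"
    and "intertwines UNIV \<sigma> \<sigma> ((\<circ>) ((\<circ>) shift_index))"
  unfolding \<sigma>_def
  by (rule intertwines_poly_act[OF intertwines_comp[OF intertwines_shift_index]],
      simp add: shift_index_def fun_eq_iff)
    (rule intertwines_poly_act[OF intertwines_comp[OF intertwines_comp[OF intertwines_shift_index]]],
      simp add: shift_index_def fun_eq_iff)

lemma module_act_x1_y: "module act_x1_y" and module_act_x_y: "module act_x_y"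
  unfolding act_x1_y_def act_x_y_def
  by (intro module_poly_act module_act_y intertwines_shift_act_y)+

lemma module_act_fls_y: "module (poly_act (pointwise (fls_scale s)) shift_index)"
  by (intro module_poly_act module_pointwise intertwines_shift_index)
    (simp add: module_iff_vector_space vector_space_fls_scale[OF vs])

lemma intertwines_fls_shift_act_y:
  "intertwines UNIV (poly_act (pointwise (fls_scale s)) shift_index)
    (poly_act (pointwise (fls_scale s)) shift_index) ((\<circ>) (fls_shift (- 1)))"
proof -
  have "intertwines UNIV (fls_scale s) (fls_scale s) (fls_shift (- 1))"
    by (rule intertwines_UNIV_I) (auto intro!: fls_eqI simp: fls_nth_fls_scale[OF vs])
  then show ?thesis
    by (intro intertwines_poly_act intertwines_comp) (auto simp: shift_index_def fun_eq_iff)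
qed

lemma module_act_fls: "module act_fls"
  unfolding act_fls_def by (intro module_poly_act module_act_fls_y intertwines_fls_shift_act_y)

lemma act_fls_fls_act: "act_fls r (\<lambda>l. fls_act s h (B l)) = (\<lambda>l. fls_act s h (act_fls r B l))"
proof -
  have "intertwines UNIV act_fls act_fls ((\<circ>) (fls_act s h))"
    unfolding act_fls_def
    by (intro intertwines_poly_act intertwines_comp intertwines_fls_act)
      (auto simp: shift_index_def fun_eq_iff fls_act_shift)
  then show ?thesis by (simp add: intertwines_def comp_def)
qed

lemma fls_nth_act_fls:
  "(\<lambda>m l. fls_nth (act_fls r B l) m) = poly_mult s r (\<lambda>m l. fls_nth (B l) m)"
proof -
  have "intertwines UNIV (pointwise (fls_scale s)) (pointwise (pointwise s)) (\<lambda>B m l. fls_nth (B l) m)"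
    by (rule intertwines_UNIV_I) (auto simp: pointwise_def fun_eq_iff fls_nth_fls_scale[OF vs])
  then have "intertwines UNIV act_fls (poly_mult s) (\<lambda>B m l. fls_nth (B l) m)"
    unfolding poly_mult_eq_poly_act act_fls_def
    by (intro intertwines_poly_act) (auto simp: shift_index_def fun_eq_iff)
  then show ?thesis by (simp add: intertwines_def)
qed

lemma poly_mult_map:
  assumes "intertwines UNIV s s \<psi>"
  shows "poly_mult s f (\<lambda>m n. \<psi> (A m n)) = (\<lambda>m n. \<psi> (poly_mult s f A m n))"
proof -
  note I = intertwinesD[OF assms, simplified]
  have "intertwines UNIV (pointwise (pointwise s)) (pointwise (pointwise s)) (\<lambda>A m n. \<psi> (A m n))"
    by (rule intertwines_UNIV_I) (auto simp: pointwise_def fun_eq_iff I)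
  then have "intertwines UNIV (poly_mult s) (poly_mult s) (\<lambda>A m n. \<psi> (A m n))"
    unfolding poly_mult_eq_poly_act
    by (intro intertwines_poly_act) (auto simp: shift_index_def fun_eq_iff)
  then show ?thesis by (simp add: intertwines_def)
qed

text \<open>
  If \<open>p(x\<^sub>1,y)\<close> kills \<open>[c(y), a(x\<^sub>1)]\<close> and \<open>q(x,y)\<close> kills \<open>[c(y), b(x)]\<close>, then the product \<open>pq\<close> kills
  \<open>f(x\<^sub>1,x) [c(y), a(x\<^sub>1) b(x)]\<close>, by the Leibniz rule
  \<open>[c, a b] = [c, a] b + a [c, b]\<close>.
\<close>

lemma commutator_annihilated:
  assumes a: "a \<in> field_space s"
    and p: "\<And>w. poly_mult s p (prod21 a c w - prod12 a c w) = 0"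
    and q: "\<And>w. poly_mult s q (prod21 b c w - prod12 b c w) = 0"
    and U: "\<And>l m n. U l m n = fls_nth (c (prod12 a b w m n)) l - prod12 a b (fls_nth (c w) l) m n"
  shows "act_x1_y p (act_x_y q (\<lambda>l. poly_mult s f (U l))) = 0"
proof -
  let ?PY = "poly_act (pointwise (pointwise (pointwise s))) shift_index
    :: _ \<Rightarrow> (int \<Rightarrow> int \<Rightarrow> int \<Rightarrow> 'w) \<Rightarrow> _"
  note aI = intertwinesD[OF field_space_mode[OF a], simplified]
  interpret P: module "poly_mult s" by (rule module_poly_mult)
  interpret MP: module act_x1_y by (rule module_act_x1_y)
  interpret MQ: module act_x_y by (rule module_act_x_y)
  define V1 where "V1 l m n = (prod21 a c (fls_nth (b w) n) - prod12 a c (fls_nth (b w) n)) m l"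
    for l m n
  define V2 where "V2 l m n = fls_nth (a ((prod21 b c w - prod12 b c w) n l)) m" for l m n
  have "fls_nth (a (u - v)) m = fls_nth (a u) m - fls_nth (a v) m" for u v m
    using aI(3)[of "u - v" v m] by simp
  then have Leibniz: "U = V1 + V2"
    by (simp add: U V1_def V2_def prod12_def prod21_def fun_eq_iff)
  \<comment> \<open>For fixed exponent of \<open>x\<close>, \<open>V1\<close> is the commutator of \<open>c\<close> and \<open>a\<close> at the vector \<open>b\<^sub>n w\<close>.\<close>
  have PV1: "act_x1_y p V1 = 0"
  proof (intro ext)
    fix l m n :: int
    have "intertwines UNIV (pointwise (pointwise (pointwise s))) (pointwise (pointwise s))
        (\<lambda>V m l. V l m n)"
      by (rule intertwines_UNIV_I) (auto simp: pointwise_def fun_eq_iff)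
    then have "intertwines UNIV act_x1_y (poly_mult s) (\<lambda>V m l. V l m n)"
      unfolding poly_mult_eq_poly_act act_x1_y_def
      by (intro intertwines_poly_act) (auto simp: shift_index_def fun_eq_iff)
    then have "(\<lambda>m l. act_x1_y p V1 l m n) = poly_mult s p (\<lambda>m l. V1 l m n)"
      by (simp add: intertwines_def)
    also have "(\<lambda>m l. V1 l m n) = prod21 a c (fls_nth (b w) n) - prod12 a c (fls_nth (b w) n)"
      by (simp add: V1_def fun_eq_iff)
    finally have "(\<lambda>m l. act_x1_y p V1 l m n) = 0" by (simp only: p)
    from fun_cong[OF fun_cong[OF this], of l m] show "act_x1_y p V1 l m n = 0 l m n" by simp
  qed
  \<comment> \<open>\<open>V2\<close> is the image under the modes of \<open>a\<close> of the commutator of \<open>c\<close> and \<open>b\<close> at \<open>w\<close>.\<close>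
  have QV2: "act_x_y q V2 = 0"
  proof -
    let ?\<psi> = "\<lambda>(B :: int \<Rightarrow> int \<Rightarrow> 'w) l m n. fls_nth (a (B n l)) m"
    have "intertwines UNIV (pointwise (pointwise s)) (pointwise (pointwise (pointwise s))) ?\<psi>"
      by (rule intertwines_UNIV_I) (auto simp: pointwise_def fun_eq_iff aI)
    then have "intertwines UNIV (poly_mult s) act_x_y ?\<psi>"
      unfolding poly_mult_eq_poly_act act_x_y_def
      by (intro intertwines_poly_act) (auto simp: shift_index_def fun_eq_iff)
    then have "act_x_y q (?\<psi> (prod21 b c w - prod12 b c w)) =
        ?\<psi> (poly_mult s q (prod21 b c w - prod12 b c w))"
      by (simp add: intertwines_def)
    then show ?thesis by (simp add: q fun_eq_iff V2_def[abs_def] aI)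
  qed
  have "act_x1_y p (act_x_y q V1) = act_x_y q (act_x1_y p V1)"
    unfolding act_x1_y_def act_x_y_def
    by (rule poly_act_commute[OF module_act_y intertwines_shift_act_y])
      (auto simp: shift_index_def fun_eq_iff)
  then have PQU: "act_x1_y p (act_x_y q U) = 0"
    by (simp add: Leibniz MP.scale_right_distrib MQ.scale_right_distrib PV1 QV2)
  let ?\<Phi> = "pointwise (poly_mult s) f :: (int \<Rightarrow> int \<Rightarrow> int \<Rightarrow> 'w) \<Rightarrow> _"
  have "intertwines UNIV (pointwise (pointwise (pointwise s))) (pointwise (pointwise (pointwise s))) ?\<Phi>"
    by (rule intertwines_UNIV_I)
      (auto simp: pointwise_def fun_eq_iff P.scale_right_distrib,
       simp add: poly_mult_def scale_sum_right mult.commute)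
  then have *: "intertwines UNIV ?PY ?PY ?\<Phi>"
    by (intro intertwines_poly_act) (auto simp: shift_index_def pointwise_def fun_eq_iff)
  have "intertwines UNIV act_x1_y act_x1_y ?\<Phi>" "intertwines UNIV act_x_y act_x_y ?\<Phi>"
    unfolding act_x1_y_def act_x_y_def
    by (rule intertwines_poly_act[OF *]; simp add: pointwise_def fun_eq_iff poly_mult_shift o_def)+
  then have "act_x1_y p (act_x_y q (?\<Phi> U)) = ?\<Phi> (act_x1_y p (act_x_y q U))"
    by (simp add: intertwines_def)
  moreover have "?\<Phi> U = (\<lambda>l. poly_mult s f (U l))" by (simp add: pointwise_def)
  moreover have "?\<Phi> 0 = 0" by (simp add: pointwise_def fun_eq_iff)
  ultimately show ?thesis by (simp only: PQU)
qed

text \<open>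
  Under \<open>x\<^sub>1 = \<alpha>x + x\<^sub>0\<close> multiplication by \<open>x\<^sub>1\<close> becomes \<open>\<alpha>x\<close> plus the shift of the \<open>x\<^sub>0\<close>-grading, so
  the annihilation argument for such operators applies to the coefficients in \<open>x\<^sub>0\<close>.
\<close>

lemma series_subst_annihilated:
  assumes "act_x1_y p (act_x_y q T) = 0" and T: "\<And>l. lower_truncated2 (T l)" and "\<alpha> \<noteq> 0"
    and "j < k"
  shows "act_fls (pcompose p [:0, [:\<alpha>:]:] ^ k * q)
    (\<lambda>l. fls_nth (series_subst s \<alpha> (T l)) (int j)) = 0"
proof -
  let ?\<sigma> = "pointwise (pointwise (pointwise s)) :: _ \<Rightarrow> (int \<Rightarrow> int \<Rightarrow> int \<Rightarrow> 'w) \<Rightarrow> _"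
  let ?\<tau> = "pointwise (fls_scale s) :: _ \<Rightarrow> (int \<Rightarrow> 'w fls) \<Rightarrow> _"
  let ?\<rho> = "poly_act ?\<tau> shift_index"
  let ?X = "(\<circ>) (fls_shift (- 1)) :: (int \<Rightarrow> 'w fls) \<Rightarrow> _"
  define Z where
    "Z = (\<lambda>(F :: nat \<Rightarrow> int \<Rightarrow> 'w fls) k. ?\<rho> [:\<alpha>:] (?X (F k)) + (if k = 0 then 0 else F (k - 1)))"
  let ?D = "{T. \<forall>l. lower_truncated2 (T l)} :: (int \<Rightarrow> int \<Rightarrow> int \<Rightarrow> 'w) set"
  let ?\<Delta> = "\<lambda>(T :: int \<Rightarrow> int \<Rightarrow> int \<Rightarrow> 'w) k l. fls_nth (series_subst s \<alpha> (T l)) (int k)"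
  have "intertwines ?D ?\<sigma> (pointwise ?\<tau>) ?\<Delta>"
    using intertwinesD[OF intertwines_series_subst[of \<alpha>]]
    by (simp add: intertwines_def pointwise_def fun_eq_iff)
  then have "intertwines ?D (poly_act ?\<sigma> shift_index)
      (poly_act (pointwise ?\<tau>) ((\<circ>) shift_index)) ?\<Delta>"
    by (rule intertwines_poly_act) (auto simp: shift_index_def fun_eq_iff)
  then have \<Delta>: "intertwines ?D (poly_act ?\<sigma> shift_index) (pointwise ?\<rho>) ?\<Delta>"
    by (simp add: poly_act_pointwise intertwines_shift_index)
  have \<Delta>P: "intertwines ?D act_x1_y (poly_act (pointwise ?\<rho>) Z) ?\<Delta>"
    unfolding act_x1_y_def
  proof (rule intertwines_poly_act[OF \<Delta>])
    fix V
    assume "V \<in> ?D"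
    moreover have "?\<rho> [:\<alpha>:] B = ?\<tau> \<alpha> B" for B
      by (simp add: poly_act_def)
    ultimately show "shift_index \<circ> V \<in> ?D \<and> ?\<Delta> (shift_index \<circ> V) = Z (?\<Delta> V)"
      using \<open>\<alpha> \<noteq> 0\<close>
      by (auto simp: Z_def pointwise_def fun_eq_iff series_subst_shift_outer
          lower_truncated2_closed)
  qed
  have \<Delta>Q: "intertwines ?D act_x_y (poly_act (pointwise ?\<rho>) ((\<circ>) ?X)) ?\<Delta>"
    unfolding act_x_y_def
    by (rule intertwines_poly_act[OF \<Delta>])
      (auto simp: fun_eq_iff series_subst_shift_inner lower_truncated2_closed)
  have "T \<in> ?D" using T by simp
  then have "act_x_y q T \<in> ?D" by (rule intertwinesD(4)[OF \<Delta>Q])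
  have "poly_act (pointwise ?\<rho>) Z p (poly_act (pointwise ?\<rho>) ((\<circ>) ?X) q (?\<Delta> T)) =
      ?\<Delta> (act_x1_y p (act_x_y q T))"
    unfolding intertwinesD(5)[OF \<Delta>P \<open>act_x_y q T \<in> ?D\<close>] intertwinesD(5)[OF \<Delta>Q \<open>T \<in> ?D\<close>] ..
  also have "\<dots> = 0"
    unfolding assms(1) by (rule intertwinesD(6)[OF \<Delta>P])
  finally show ?thesis
    unfolding act_fls_def using \<open>j < k\<close>
    by (intro poly_act_shift_annihilates[OF module_act_fls_y intertwines_fls_shift_act_y])
      (auto simp: Z_def)
qed

text \<open>
  The analogue of Dong's lemma.  The lowest power of \<open>x\<^sub>0\<close> in \<open>\<iota> f(\<alpha>x + x\<^sub>0, x)\<^sup>-\<^sup>1\<close> is independent of the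
  vector \<open>w\<close>, so that only boundedly many coefficients of \<open>x\<^sub>0\<close> enter into the coefficient in question
  and one polynomial \<open>p(\<alpha>x, y)\<^sup>K q(x, y)\<close> works for every \<open>w\<close>.  Beyond this nothing about that inverse
  matters.
\<close>

lemma mutually_quasi_local_Y_prod:
  assumes a: "a \<in> field_space s" and c: "c \<in> field_space s"
    and "compatible s a b" and "mutually_quasi_local s a c" and "mutually_quasi_local s b c"
    and "\<alpha> \<noteq> 0"
  shows "mutually_quasi_local s (Y_prod s \<alpha> n a b) c"
proof -
  interpret P: module "poly_mult s" by (rule module_poly_mult)
  interpret R: module act_fls by (rule module_act_fls)
  define f where "f = (SOME f. compat_poly s a b f)"
  define g where "g = inverse (poly_subst \<alpha> f)"
  define N where "N = - n - 1"
  let ?e = "Y_prod s \<alpha> n a b"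
  have e: "?e v = (\<Sum>i = fls_subdegree g..N. fls_act s (fls_nth g i)
      (fls_nth (series_subst s \<alpha> (poly_mult s f (prod12 a b v))) (N - i)))" for v
    by (simp add: Y_prod_eq_sum Let_def f_def g_def N_def)
  have "compat_poly s a b f"
    using \<open>compatible s a b\<close> unfolding f_def compatible_def by (rule someI_ex)
  then have trunc: "lower_truncated2 (poly_mult s f (prod12 a b w))" for w
    by (simp add: compat_poly_def)
  obtain p where "p \<noteq> 0" and p: "\<And>w. poly_mult s p (prod21 a c w - prod12 a c w) = 0"
    using assms(4) unfolding mutually_quasi_local_iff by blast
  obtain q where "q \<noteq> 0" and q: "\<And>w. poly_mult s q (prod21 b c w - prod12 b c w) = 0"
    using assms(5) unfolding mutually_quasi_local_iff by blast
  \<comment> \<open>The sum for the product involves only the coefficients of \<open>x\<^sub>0\<^sup>j\<close> with \<open>j < K\<close>.\<close>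
  define K where "K = nat (N - fls_subdegree g) + 1"
  define r where "r = pcompose p [:0, [:\<alpha>:]:] ^ K * q"
  have "pcompose p [:0, [:\<alpha>:]:] \<noteq> 0"
    using \<open>p \<noteq> 0\<close> \<open>\<alpha> \<noteq> 0\<close> pcompose_eq_0[of p "[:0, [:\<alpha>:]:]"] by auto
  then have "r \<noteq> 0" using \<open>q \<noteq> 0\<close> by (simp add: r_def)
  have "poly_mult s r (prod21 ?e c w - prod12 ?e c w) = 0" for w
  proof -
    note cI = intertwinesD[OF field_space_mode[OF c], simplified]
    define U where "U l m n = fls_nth (c (prod12 a b w m n)) l - prod12 a b (fls_nth (c w) l) m n"
      for l m n
    define T where "T l = poly_mult s f (U l)" for l
    define A1 where "A1 l = (\<lambda>m n. fls_nth (c (poly_mult s f (prod12 a b w) m n)) l)" for l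
    define A2 where "A2 l = poly_mult s f (prod12 a b (fls_nth (c w) l))" for l
    have A1: "lower_truncated2 (A1 l)" for l
      unfolding A1_def by (rule series_subst_map[OF field_space_mode[OF c] trunc])
    have A2: "lower_truncated2 (A2 l)" for l
      unfolding A2_def by (rule trunc)
    have "U l = (\<lambda>m n. fls_nth (c (prod12 a b w m n)) l) - prod12 a b (fls_nth (c w) l)" for l
      by (simp add: U_def fun_eq_iff)
    then have A1_eq: "A1 l = T l + A2 l" for l
      by (simp add: T_def A1_def A2_def P.scale_right_diff_distrib
          poly_mult_map[OF field_space_mode[OF c]])
    have "T l = A1 l + pointwise (pointwise s) (- 1) (A2 l)" for l
      by (simp add: A1_eq pointwise_def fun_eq_iff)
    then have T: "lower_truncated2 (T l)" for l
      using A1 A2 by (simp add: lower_truncated2_closed)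
    have "act_x1_y p (act_x_y q T) = 0"
      unfolding T_def by (rule commutator_annihilated[OF a p q U_def])
    then have ann: "act_fls r (\<lambda>l. fls_nth (series_subst s \<alpha> (T l)) (int j)) = 0" if "j < K" for j
      unfolding r_def by (rule series_subst_annihilated[OF _ T \<open>\<alpha> \<noteq> 0\<close> that])
    \<comment> \<open>\<open>B\<close> is the commutator of \<open>c(y)\<close> with the product, as a series in \<open>y\<close> over \<open>W((x))\<close>.\<close>
    define B where "B = (\<Sum>i = fls_subdegree g..N.
      (\<lambda>l. fls_act s (fls_nth g i) (fls_nth (series_subst s \<alpha> (T l)) (N - i))))"
    have "act_fls r B = 0"
      unfolding B_def R.scale_sum_right
    proof (rule sum.neutral, rule ballI)
      fix i
      assume i: "i \<in> {fls_subdegree g..N}"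
      define j where "j = nat (N - i)"
      have "N - i = int j" "j < K" using i by (auto simp: j_def K_def)
      then have "act_fls r (\<lambda>l. fls_nth (series_subst s \<alpha> (T l)) (N - i)) = 0"
        using ann by simp
      then show "act_fls r
          (\<lambda>l. fls_act s (fls_nth g i) (fls_nth (series_subst s \<alpha> (T l)) (N - i))) = 0"
        unfolding act_fls_fls_act
        by (simp add: fun_eq_iff intertwinesD(6)[OF intertwines_fls_act])
    qed
    moreover have "prod21 ?e c w - prod12 ?e c w = (\<lambda>m l. fls_nth (B l) m)"
    proof (intro ext)
      fix m l
      have c_sum: "fls_nth (c (sum h I)) l = (\<Sum>i\<in>I. fls_nth (c (h i)) l)" for h and I :: "int set"
        by (induction I rule: infinite_finite_induct) (simp_all add: cI)
      have "prod21 ?e c w m l = (\<Sum>i = fls_subdegree g..N. fls_nth (fls_act s (fls_nth g i)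
          (fls_nth (series_subst s \<alpha> (A1 l)) (N - i))) m)"
        unfolding prod21_def e fls_nth_sum c_sum A1_def
        by (intro sum.cong refl fls_act_map[OF field_space_mode[OF c], symmetric]
            series_subst_map(2)[OF field_space_mode[OF c] trunc])
      moreover have "prod12 ?e c w m l = (\<Sum>i = fls_subdegree g..N. fls_nth (fls_act s (fls_nth g i)
          (fls_nth (series_subst s \<alpha> (A2 l)) (N - i))) m)"
        unfolding prod12_def e fls_nth_sum A2_def by simp
      moreover have "fls_act s (fls_nth g i) (fls_nth (series_subst s \<alpha> (A1 l)) (N - i)) =
          fls_act s (fls_nth g i) (fls_nth (series_subst s \<alpha> (T l)) (N - i)) +
          fls_act s (fls_nth g i) (fls_nth (series_subst s \<alpha> (A2 l)) (N - i))"
        if "i \<in> {fls_subdegree g..N}" for i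
      proof -
        have "N - i = int (nat (N - i))" using that by simp
        then show ?thesis
          using T A2 intertwinesD(3)[OF intertwines_series_subst[of \<alpha> "nat (N - i)"]]
            intertwinesD(3)[OF intertwines_fls_act]
          by (simp add: A1_eq)
      qed
      ultimately show "(prod21 ?e c w - prod12 ?e c w) m l = fls_nth (B l) m"
        by (simp add: B_def sum_apply fls_nth_sum sum.distrib)
    qed
    ultimately show ?thesis by (simp add: zero_fun_def flip: fls_nth_act_fls)
  qed
  with \<open>r \<noteq> 0\<close> show ?thesis
    unfolding mutually_quasi_local_iff by blast
qed

section \<open>Maximal quasi local subspaces\<close>

lemma field_subspace_mutually_quasi_local:
  assumes c: "c \<in> field_space s"
  shows "field_subspace s {a \<in> field_space s. mutually_quasi_local s a c}"
proof -
  interpret FL: vector_space "field_scale s" by (rule vector_space_field_scale) (rule vs)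
  interpret FS: vector_space "fls_scale s" by (rule vector_space_fls_scale) (rule vs)
  interpret P: module "poly_mult s" by (rule module_poly_mult)
  note cI = intertwinesD[OF field_space_mode[OF c], simplified]
  let ?C = "\<lambda>a w. prod21 a c w - prod12 a c w"
  let ?U = "{a \<in> field_space s. mutually_quasi_local s a c}"
  have "FL.subspace ?U"
  proof (rule FL.subspaceI)
    show "0 \<in> ?U"
      by (auto simp: field_space_iff intertwines_def mutually_quasi_local_def prod12_def
          prod21_def cI fun_eq_iff intro!: exI[of _ 1])
  next
    fix a b
    assume ab: "a \<in> ?U" "b \<in> ?U"
    then obtain f g where fg: "f \<noteq> 0" "g \<noteq> 0" "\<And>w. poly_mult s f (?C a w) = 0"
        "\<And>w. poly_mult s g (?C b w) = 0"
      by (auto simp: mutually_quasi_local_iff)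
    have "?C (a + b) w = ?C a w + ?C b w" for w
      by (simp add: prod12_def prod21_def fun_eq_iff cI)
    then have "poly_mult s (f * g) (?C (a + b) w) =
        poly_mult s g (poly_mult s f (?C a w)) + poly_mult s f (poly_mult s g (?C b w))" for w
      by (simp add: P.scale_right_distrib mult.commute)
    then have "poly_mult s (f * g) (?C (a + b) w) = 0" for w
      by (simp add: fg)
    moreover have "f * g \<noteq> 0" using fg by simp
    ultimately have "mutually_quasi_local s (a + b) c"
      unfolding mutually_quasi_local_iff by blast
    then show "a + b \<in> ?U"
      using ab by (auto simp: field_space_iff intertwines_def FS.scale_right_distrib)
  next
    fix k a
    assume a: "a \<in> ?U"
    then obtain f where f: "f \<noteq> 0" "\<And>w. poly_mult s f (?C a w) = 0"
      by (auto simp: mutually_quasi_local_iff)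
    have "?C (field_scale s k a) w = pointwise (pointwise s) k (?C a w)" for w
      by (simp add: prod12_def prod21_def field_scale_def fls_nth_fls_scale[OF vs] pointwise_def
          fun_eq_iff cI scale_right_diff_distrib)
    moreover have "poly_mult s f (pointwise (pointwise s) k A) =
        pointwise (pointwise s) k (poly_mult s f A)" for A
      by (simp add: poly_mult_def fun_eq_iff pointwise_def scale_sum_right mult.commute)
    moreover have "pointwise (pointwise s) k 0 = 0"
      by (simp add: pointwise_def fun_eq_iff)
    ultimately have "mutually_quasi_local s (field_scale s k a) c"
      unfolding mutually_quasi_local_iff using f by metis
    then show "field_scale s k a \<in> ?U"
      using a by (auto simp: field_space_iff intertwines_def field_scale_def
          FS.scale_right_distrib mult.commute)
  qed
  then show ?thesis by (auto simp: field_subspace_def)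
qed

lemma quasi_local_span:
  assumes "quasi_local s S"
  shows "field_subspace s (module.span (field_scale s) S)"
    and "quasi_local s (module.span (field_scale s) S)"
proof -
  interpret FL: vector_space "field_scale s" by (rule vector_space_field_scale) (rule vs)
  have S: "S \<subseteq> field_space s" "\<And>a c. a \<in> S \<Longrightarrow> c \<in> S \<Longrightarrow> mutually_quasi_local s a c"
    using assms by (auto simp: quasi_local_def)
  have span: "FL.span X \<subseteq> {a \<in> field_space s. mutually_quasi_local s a c}"
    if "X \<subseteq> {a \<in> field_space s. mutually_quasi_local s a c}" "c \<in> field_space s" for X c
    using that field_subspace_mutually_quasi_local[of c]
    by (intro FL.span_minimal) (auto simp: field_subspace_def)
  have left: "FL.span S \<subseteq> {a \<in> field_space s. mutually_quasi_local s a c}" if "c \<in> S" for c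
    by (rule span) (use that S in auto)
  have "S \<subseteq> {a \<in> field_space s. mutually_quasi_local s a identity_field}"
    using S(1) mutually_quasi_local_identity_field mutually_quasi_local_sym by blast
  then have span_S: "FL.span S \<subseteq> field_space s"
    using span identity_field_in_field_space by blast
  have both: "FL.span S \<subseteq> {a \<in> field_space s. mutually_quasi_local s a c}" if "c \<in> FL.span S" for c
  proof (rule span)
    show "S \<subseteq> {a \<in> field_space s. mutually_quasi_local s a c}"
      using left that S(1) mutually_quasi_local_sym by blast
    show "c \<in> field_space s" using that span_S by blast
  qed
  then show "quasi_local s (FL.span S)"
    unfolding quasi_local_def by blast
  show "field_subspace s (FL.span S)"
    using span_S by (simp add: field_subspace_def)
qed

lemma quasi_local_insert:
  assumes "quasi_local s U" and "e \<in> field_space s" and "mutually_quasi_local s e e"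
    and "\<And>c. c \<in> U \<Longrightarrow> mutually_quasi_local s e c"
  shows "quasi_local s (insert e U)"
  using assms mutually_quasi_local_sym unfolding quasi_local_def by blast

lemma maximal_quasi_local_subspace_mem:
  assumes max: "maximal_quasi_local_subspace s U"
    and e: "e \<in> field_space s" "mutually_quasi_local s e e"
      "\<And>c. c \<in> U \<Longrightarrow> mutually_quasi_local s e c"
  shows "e \<in> U"
proof -
  interpret FL: vector_space "field_scale s" by (rule vector_space_field_scale) (rule vs)
  have "quasi_local s (insert e U)"
    using max e by (intro quasi_local_insert) (auto simp: maximal_quasi_local_subspace_def)
  from quasi_local_span[OF this] have "FL.span (insert e U) = U"
    using max FL.span_superset[of "insert e U"] unfolding maximal_quasi_local_subspace_def by blast
  then show ?thesis using FL.span_superset[of "insert e U"] by blast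
qed

lemma identity_field_in_maximal:
  assumes "maximal_quasi_local_subspace s U"
  shows "identity_field \<in> U"
  using assms
  by (intro maximal_quasi_local_subspace_mem[OF assms] identity_field_in_field_space
      mutually_quasi_local_identity_field)
    (auto simp: maximal_quasi_local_subspace_def quasi_local_def)

lemma Y_closed_maximal:
  assumes max: "maximal_quasi_local_subspace s U" and "subgroup \<Gamma> nonzero_complex_group"
  shows "Y_closed s \<Gamma> U"
proof -
  have U: "field_subspace s U" "U \<subseteq> field_space s"
    and ql: "\<And>a b. a \<in> U \<Longrightarrow> b \<in> U \<Longrightarrow> mutually_quasi_local s a b"
    using max by (auto simp: maximal_quasi_local_subspace_def quasi_local_def)
  have compat: "compatible s a b" if "a \<in> U" "b \<in> U" for a b
    using that U ql by (intro compatible_if_mutually_quasi_local) auto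
  have "Y_prod s \<alpha> n a b \<in> U" if ab: "a \<in> U" "b \<in> U" and "\<alpha> \<in> \<Gamma>" for a b \<alpha> n
  proof (rule maximal_quasi_local_subspace_mem[OF max])
    have \<alpha>: "\<alpha> \<noteq> 0"
      using subgroup.subset[OF assms(2)] \<open>\<alpha> \<in> \<Gamma>\<close> by (auto simp: nonzero_complex_group_def)
    note Y = mutually_quasi_local_Y_prod[OF _ _ compat[OF ab] _ _ \<alpha>, of _ n]
    show F: "Y_prod s \<alpha> n a b \<in> field_space s"
      using ab U compat by (intro Y_prod_in_field_space) auto
    show C: "mutually_quasi_local s (Y_prod s \<alpha> n a b) c" if "c \<in> U" for c
      using ab that U ql by (intro Y) auto
    \<comment> \<open>The product is quasi local with \<open>a\<close> and \<open>b\<close> by the previous step, so it can itself take the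
      place of \<open>c\<close>.\<close>
    show "mutually_quasi_local s (Y_prod s \<alpha> n a b) (Y_prod s \<alpha> n a b)"
      using ab U F C mutually_quasi_local_sym by (intro Y) auto
  qed
  with U compat show ?thesis
    unfolding Y_closed_def pairwise_compatible_subspace_def by blast
qed

text \<open>
  Zorn's lemma is applied to quasi local sets; a maximal one equals its span and is thus a subspace.
\<close>

lemma maximal_quasi_local_subspace_exists:
  assumes "quasi_local s S"
  obtains U where "maximal_quasi_local_subspace s U" and "S \<subseteq> U"
proof -
  interpret FL: vector_space "field_scale s" by (rule vector_space_field_scale) (rule vs)
  let ?A = "{X. quasi_local s X \<and> S \<subseteq> X}"
  have "\<exists>M\<in>?A. \<forall>X\<in>?A. M \<subseteq> X \<longrightarrow> X = M"
  proof (rule subset_Zorn_nonempty)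
    show "?A \<noteq> {}" using assms by blast
  next
    fix C
    assume "C \<noteq> {}" and C: "subset.chain ?A C"
    have "mutually_quasi_local s a b" if "a \<in> \<Union>C" "b \<in> \<Union>C" for a b
    proof -
      from that obtain X Y where "X \<in> C" "a \<in> X" "Y \<in> C" "b \<in> Y" by blast
      moreover have "X \<subseteq> Y \<or> Y \<subseteq> X"
        using C \<open>X \<in> C\<close> \<open>Y \<in> C\<close> by (auto simp: subset_chain_def)
      moreover have "quasi_local s X" "quasi_local s Y"
        using C \<open>X \<in> C\<close> \<open>Y \<in> C\<close> by (auto simp: subset_chain_def)
      ultimately show ?thesis unfolding quasi_local_def by blast
    qed
    moreover have "\<Union>C \<subseteq> field_space s"
      using C by (auto simp: subset_chain_def quasi_local_def)
    moreover have "S \<subseteq> \<Union>C"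
      using C \<open>C \<noteq> {}\<close> unfolding subset_chain_def by blast
    ultimately show "\<Union>C \<in> ?A" by (simp add: quasi_local_def)
  qed
  then obtain U where "U \<in> ?A" and "\<forall>X\<in>?A. U \<subseteq> X \<longrightarrow> X = U" ..
  then have U: "quasi_local s U" "S \<subseteq> U"
    and max: "\<And>X. quasi_local s X \<Longrightarrow> U \<subseteq> X \<Longrightarrow> X = U"
    by auto
  have "FL.span U = U"
    by (rule max[OF quasi_local_span(2)[OF U(1)] FL.span_superset])
  then have "field_subspace s U"
    using quasi_local_span(1)[OF U(1)] by metis
  with U max have "maximal_quasi_local_subspace s U"
    by (auto simp: maximal_quasi_local_subspace_def)
  then show thesis using U(2) by (rule that)
qed

end

theorem corollary4p5:
  fixes s :: "complex \<Rightarrow> 'w::ab_group_add \<Rightarrow> 'w"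
  assumes "vector_space s"
  shows "(\<forall>U. maximal_quasi_local_subspace s U \<longrightarrow>
            identity_field \<in> U \<and>
            (\<forall>\<Gamma>. subgroup \<Gamma> nonzero_complex_group \<longrightarrow> Y_closed s \<Gamma> U)) \<and>
         (\<forall>S \<Gamma>. quasi_local s S \<and> subgroup \<Gamma> nonzero_complex_group \<longrightarrow>
            (\<exists>V. field_subspace s V \<and> quasi_local s V \<and> Y_closed s \<Gamma> V \<and>
                 S \<subseteq> V \<and> identity_field \<in> V))"
proof (intro conjI allI impI)
  fix U
  assume "maximal_quasi_local_subspace s U"
  then show "identity_field \<in> U" by (rule identity_field_in_maximal[OF assms])
next
  fix U \<Gamma>
  assume "maximal_quasi_local_subspace s U" "subgroup \<Gamma> nonzero_complex_group"
  then show "Y_closed s \<Gamma> U" by (rule Y_closed_maximal[OF assms])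
next
  fix S \<Gamma>
  assume S: "quasi_local s S \<and> subgroup \<Gamma> nonzero_complex_group"
  then obtain U where U: "maximal_quasi_local_subspace s U" "S \<subseteq> U"
    using maximal_quasi_local_subspace_exists[OF assms] by blast
  moreover have "field_subspace s U" "quasi_local s U"
    using U(1) by (auto simp: maximal_quasi_local_subspace_def)
  ultimately show "\<exists>V. field_subspace s V \<and> quasi_local s V \<and> Y_closed s \<Gamma> V \<and>
      S \<subseteq> V \<and> identity_field \<in> V"
    using S identity_field_in_maximal[OF assms] Y_closed_maximal[OF assms] by blast
qed

end
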